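(* Let $\pi$ be an irreducible permutation on a finite alphabet $\mathcal{A}$. Then the action of the Rauzy monoid $\Pi(\pi)$ on the space of Lagrangian flags $\mathcal{L}(H(\pi))$, given by $\gamma\cdot h=\Theta(\gamma)h$, is minimal: the only nonempty closed subset $C\subset\mathcal{L}(H(\pi))$ with $\Theta(\gamma)\cdot C=C$ for all $\gamma\in\Pi(\pi)$ is $\mathcal{L}(H(\pi))$ itself.
   Context: A permutation is a pair $\pi=(\pi_0,\pi_1)$ of bijections $\mathcal{A}\to\{1,\dots,d\}$, $d=\#\mathcal{A}\ge2$; it is irreducible if there is no $1\le k<d$ with $\pi_0^{-1}(\{1,\dots,k\})=\pi_1^{-1}(\{1,\dots,k\})$. $\Omega(\pi)$ is the operator on $\mathbb{R}^{\mathcal{A}}$ with $\langle\Omega(\pi)e_x,e_y\rangle=1$ if $\pi_0(x)>\pi_0(y),\pi_1(x)<\pi_1(y)$; $-1$ if $\pi_0(x)<\pi_0(y),\pi_1(x)>\pi_1(y)$; $0$ otherwise. $H(\pi)=\Omega(\pi)\mathbb{R}^{\mathcal{A}}$, with symplectic form $\omega_\pi(\Omega(\pi)u,\Omega(\pi)v)=\langle u,\Omega(\pi)v\rangle$, $\dim H(\pi)=2g$. Rauzy operations: with $x,y$ the last letters of top and bottom rows, the top operation moves $y$ in the bottom row to just right of $x$ (winner $x$, loser $y$), the bottom operation moves $x$ in the top row to just right of $y$ (winner $y$, loser $x$). The Rauzy diagram has arrows from $\pi$ to these images; $\Pi(\pi)$ is the monoid (under concatenation) of paths starting and ending at $\pi$.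 For an arrow with winner $w$ and loser $\ell$, $\Theta(\gamma)e_w=e_w+e_\ell$, $\Theta(\gamma)e_z=e_z$ otherwise, and $\Theta(\gamma_1\gamma_2)=\Theta(\gamma_2)\Theta(\gamma_1)$; for $\gamma\in\Pi(\pi)$, $\Theta(\gamma)$ is a symplectic automorphism of $(H(\pi),\omega_\pi)$. A Lagrangian flag is a sequence $(F_i)_{i=1}^g$ of subspaces with $\dim F_i=i$, $F_i\subset F_{i+1}$, each $F_i$ isotropic ($\omega_\pi$ vanishes on $F_i$). *)

theory Defs
  imports "HOL-Analysis.Analysis"
begin

type_synonym 'a perm = "('a \<Rightarrow> nat) \<times> ('a \<Rightarrow> nat)"

definition is_perm :: "'a::finite perm \<Rightarrow> bool" where
  "is_perm p \<longleftrightarrow> bij_betw (fst p) UNIV {1..CARD('a)} \<and> bij_betw (snd p) UNIV {1..CARD('a)}"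

definition irreducible_perm :: "'a::finite perm \<Rightarrow> bool" where
  "irreducible_perm p \<longleftrightarrow> is_perm p \<and>
     \<not> (\<exists>k. 1 \<le> k \<and> k < CARD('a) \<and> fst p -` {1..k} = snd p -` {1..k})"

text \<open>Entry <Omega(pi) e_x, e_y>.\<close>
definition omega_entry :: "'a perm \<Rightarrow> 'a \<Rightarrow> 'a \<Rightarrow> real" where
  "omega_entry p x y =
     (if fst p x > fst p y \<and> snd p x < snd p y then 1
      else if fst p x < fst p y \<and> snd p x > snd p y then -1 else 0)"

definition Omega :: "'a::finite perm \<Rightarrow> real^'a \<Rightarrow> real^'a" where
  "Omega p v = (\<chi> y. \<Sum>x\<in>UNIV. omega_entry p x y * v $ x)"

definition H :: "'a::finite perm \<Rightarrow> (real^'a) set" where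
  "H p = range (Omega p)"

text \<open>omega_pi(Omega u, Omega v) = <u, Omega v>; well defined on H(pi).\<close>
definition sympl :: "'a::finite perm \<Rightarrow> real^'a \<Rightarrow> real^'a \<Rightarrow> real" where
  "sympl p a b = inner (inv_into UNIV (Omega p) a) b"

definition genus :: "'a::finite perm \<Rightarrow> nat" where
  "genus p = dim (H p) div 2"

datatype rauzy_op = TopOp | BotOp

definition last_top :: "'a::finite perm \<Rightarrow> 'a" where
  "last_top p = (THE a. fst p a = CARD('a))"

definition last_bot :: "'a::finite perm \<Rightarrow> 'a" where
  "last_bot p = (THE a. snd p a = CARD('a))"

definition rauzy_step :: "rauzy_op \<Rightarrow> 'a::finite perm \<Rightarrow> 'a perm" where
  "rauzy_step t p = (let x = last_top p; y = last_bot p in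
     (case t of
        TopOp \<Rightarrow> (fst p, \<lambda>z. if z = y then snd p x + 1
                            else if snd p z > snd p x then snd p z + 1 else snd p z)
      | BotOp \<Rightarrow> (\<lambda>z. if z = x then fst p y + 1
                            else if fst p z > fst p y then fst p z + 1 else fst p z, snd p)))"

definition winner :: "rauzy_op \<Rightarrow> 'a::finite perm \<Rightarrow> 'a" where
  "winner t p = (case t of TopOp \<Rightarrow> last_top p | BotOp \<Rightarrow> last_bot p)"

definition loser :: "rauzy_op \<Rightarrow> 'a::finite perm \<Rightarrow> 'a" where
  "loser t p = (case t of TopOp \<Rightarrow> last_bot p | BotOp \<Rightarrow> last_top p)"

definition theta_arrow :: "rauzy_op \<Rightarrow> 'a::finite perm \<Rightarrow> real^'a \<Rightarrow> real^'a" where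
  "theta_arrow t p v = v + (v $ winner t p) *\<^sub>R axis (loser t p) 1"

fun path_end :: "'a::finite perm \<Rightarrow> rauzy_op list \<Rightarrow> 'a perm" where
  "path_end p [] = p"
| "path_end p (t # ts) = path_end (rauzy_step t p) ts"

text \<open>Theta(gamma1 gamma2) = Theta(gamma2) Theta(gamma1).\<close>
fun theta_path :: "'a::finite perm \<Rightarrow> rauzy_op list \<Rightarrow> real^'a \<Rightarrow> real^'a" where
  "theta_path p [] = id"
| "theta_path p (t # ts) = theta_path (rauzy_step t p) ts \<circ> theta_arrow t p"

definition rauzy_monoid :: "'a::finite perm \<Rightarrow> rauzy_op list set" where
  "rauzy_monoid p = {ts. path_end p ts = p}"

definition isotropic :: "'a::finite perm \<Rightarrow> (real^'a) set \<Rightarrow> bool" where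
  "isotropic p F \<longleftrightarrow> (\<forall>a\<in>F. \<forall>b\<in>F. sympl p a b = 0)"

definition lagr_flags :: "'a::finite perm \<Rightarrow> (nat \<Rightarrow> (real^'a) set) set" where
  "lagr_flags p = {F. (\<forall>i\<in>{1..genus p}. subspace (F i) \<and> F i \<subseteq> H p \<and> dim (F i) = i
                          \<and> isotropic p (F i))
                    \<and> (\<forall>i. 1 \<le> i \<and> i < genus p \<longrightarrow> F i \<subseteq> F (Suc i))
                    \<and> (\<forall>i. i \<notin> {1..genus p} \<longrightarrow> F i = {})}"

definition flag_act :: "'a::finite perm \<Rightarrow> rauzy_op list \<Rightarrow> (nat \<Rightarrow> (real^'a) set) \<Rightarrow> nat \<Rightarrow> (real^'a) set" where
  "flag_act p ts F = (\<lambda>i. if i \<in> {1..genus p} then theta_path p ts ` F i else {})"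

text \<open>Topology on the flag space: each subspace V is identified with the matrix of the
  orthogonal projection onto V (this realises the usual topology of the Grassmannian);
  a flag is mapped into the product space nat => real^'a^'a.\<close>
definition orth_proj :: "(real^'a::finite) set \<Rightarrow> real^'a \<Rightarrow> real^'a" where
  "orth_proj V x = (THE q. q \<in> V \<and> (\<forall>v\<in>V. inner (x - q) v = 0))"

definition proj_mat :: "(real^'a::finite) set \<Rightarrow> real^'a^'a" where
  "proj_mat V = matrix (orth_proj V)"

definition flag_emb :: "'a::finite perm \<Rightarrow> (nat \<Rightarrow> (real^'a) set) \<Rightarrow> nat \<Rightarrow> real^'a^'a" where
  "flag_emb p F = (\<lambda>i. if i \<in> {1..genus p} then proj_mat (F i) else 0)"

definition closed_flag_set :: "'a::finite perm \<Rightarrow> (nat \<Rightarrow> (real^'a) set) set \<Rightarrow> bool" where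
  "closed_flag_set p C \<longleftrightarrow>
     closedin (top_of_set (flag_emb p ` lagr_flags p)) (flag_emb p ` C)"

end

theory Submission
  imports Defs
begin

text \<open>Invariance is an equality of sets, so \<open>C\<close> is invariant under the group generated by the maps
  \<open>\<Theta>(\<gamma>)\<close>, which contains many integral transvections. Every letter \<open>w\<close> can be moved to the end of a
  row by a path along which it never loses. Winning with \<open>w\<close> until the other row is back in place is
  then a loop, and conjugating this loop by the path shows that \<open>C\<close> is invariant under
  \<open>T\<^sub>w v = v + v\<^sub>w \<Omega>(\<pi>) e\<^sub>w\<close>.

  Powers of transvections converge on flags, so that \<open>C\<close> is also invariant under the limits. The set of
  parameters that occur in these limits is closed and invariant under the \<open>T\<^sub>w\<close>. It is everything: the
  letters are connected by pairs with \<open>\<langle>\<Omega>(\<pi>) e\<^sub>w, e\<^sub>z\<rangle> = \<plusminus>1\<close>, each of which generates a copy of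
  \<open>SL\<^sub>2(\<int>)\<close>, whose orbits of lines are dense in the plane. Hence \<open>C\<close> is invariant under all real
  symplectic transvections, and these act transitively on Lagrangian flags.\<close>

text \<open>Integral matrices only converge to integral ones, so no limit of the \<Theta>(\<gamma>)
  as matrices is a new real transvection. The real parameters arise on flags: if
  \<open>v \<bullet> x \<noteq> 0\<close>, powers of the transvection along \<open>Omega p v\<close>
  turn the line of \<open>x\<close> towards the line of \<open>Omega p v\<close>. That line does not
  see the length of \<open>v\<close>, so \<open>v\<close> may be replaced by any nonzero real
  multiple \<open>c v\<close>. The same line is reached by one real transvection, with parameter
  \<open>c v - h\<close> where \<open>Omega p h = x\<close>; it takes \<open>x\<close> to
  \<open>c Omega p v\<close>. Since this move depends on the first vector of a frame, a parameter
  counts as good only if it works for all frames with flag in \<open>C\<close>. Good parameters may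
  be conjugated by the integral transvections, and once all of them are good, the parameter
  \<open>c u + h\<close> cancels \<open>h\<close> and leaves the transvection along an arbitrary
  \<open>u\<close>. Parameters are vectors of the full coordinate space, not of \<open>H p\<close>:
  \<open>Omega p\<close> may have a kernel, and the symplectic product of \<open>Omega p u\<close>
  with \<open>x\<close> is then simply \<open>u \<bullet> x\<close>.\<close>

lemma omega_entry_antisym: "omega_entry p x y = - omega_entry p y x"
  by (auto simp: omega_entry_def)

lemma omega_entry_swap: "omega_entry (prod.swap p) x y = - omega_entry p x y"
  by (auto simp: omega_entry_def)

lemma Omega_axis: "Omega p (axis w 1) $ y = omega_entry p w y"
  by (simp add: Omega_def axis_def if_distrib cong: if_cong)

lemma linear_Omega: "linear (Omega p)"
  by (rule linearI)
    (simp_all add: Omega_def vec_eq_iff algebra_simps sum.distrib sum_distrib_left)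

lemma inner_Omega: "u \<bullet> Omega p v = - (Omega p u \<bullet> v)"
proof -
  have "u \<bullet> Omega p v = (\<Sum>y\<in>UNIV. \<Sum>x\<in>UNIV. omega_entry p x y * u $ y * v $ x)"
    by (simp add: inner_vec_def Omega_def sum_distrib_left mult_ac)
  also have "\<dots> = (\<Sum>x\<in>UNIV. \<Sum>y\<in>UNIV. omega_entry p x y * u $ y * v $ x)"
    by (rule sum.swap)
  also have "\<dots> = - (\<Sum>x\<in>UNIV. \<Sum>y\<in>UNIV. omega_entry p y x * u $ y * v $ x)"
    by (subst omega_entry_antisym) (simp add: sum_negf)
  finally show ?thesis
    by (simp add: inner_vec_def Omega_def sum_distrib_right)
qed

lemma inner_Omega_self [simp]: "u \<bullet> Omega p u = 0"
  using inner_Omega[of u p u] by (simp add: inner_commute)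

section \<open>Rauzy paths\<close>

lemma is_perm_swap: "is_perm (prod.swap p) \<longleftrightarrow> is_perm p"
  by (auto simp: is_perm_def)

lemma irreducible_perm_swap: "irreducible_perm (prod.swap p) \<longleftrightarrow> irreducible_perm p"
  unfolding irreducible_perm_def is_perm_swap by (metis fst_swap snd_swap)

lemma last_top_swap: "last_top (prod.swap p) = last_bot p"
  by (simp add: last_top_def last_bot_def)

lemma last_bot_swap: "last_bot (prod.swap p) = last_top p"
  by (simp add: last_top_def last_bot_def)

lemma rauzy_step_BotOp: "rauzy_step BotOp p = prod.swap (rauzy_step TopOp (prod.swap p))"
  unfolding rauzy_step_def Let_def last_top_swap last_bot_swap by (simp add: fun_eq_iff)

lemma theta_arrow_BotOp: "theta_arrow BotOp p = theta_arrow TopOp (prod.swap p)"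
  by (simp add: theta_arrow_def winner_def loser_def last_top_swap last_bot_swap fun_eq_iff)

lemma Omega_swap: "Omega (prod.swap p) v = - Omega p v"
  by (simp add: Omega_def vec_eq_iff omega_entry_swap sum_negf)

context
  fixes p :: "'a::finite perm"
  assumes perm: "is_perm p"
begin

lemma inj_fst_perm: "inj (fst p)" and inj_snd_perm: "inj (snd p)"
  using perm by (auto simp: is_perm_def bij_betw_def)

lemma fst_perm_bounds: "1 \<le> fst p z" "fst p z \<le> CARD('a)"
  using perm by (auto simp: is_perm_def bij_betw_def)

lemma snd_perm_bounds: "1 \<le> snd p z" "snd p z \<le> CARD('a)"
  using perm by (auto simp: is_perm_def bij_betw_def)

lemma last_top_eq_iff: "last_top p = z \<longleftrightarrow> fst p z = CARD('a)"
proof -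
  have "CARD('a) \<in> fst p ` UNIV"
    using perm by (auto simp: is_perm_def bij_betw_def Suc_le_eq)
  then obtain a where a: "fst p a = CARD('a)" by auto
  have "last_top p = a"
    unfolding last_top_def by (rule the_equality) (use a inj_fst_perm in \<open>auto simp: inj_def\<close>)
  then show ?thesis using a inj_fst_perm by (auto simp: inj_def)
qed

lemma last_bot_eq_iff: "last_bot p = z \<longleftrightarrow> snd p z = CARD('a)"
proof -
  have "CARD('a) \<in> snd p ` UNIV"
    using perm by (auto simp: is_perm_def bij_betw_def Suc_le_eq)
  then obtain a where a: "snd p a = CARD('a)" by auto
  have "last_bot p = a"
    unfolding last_bot_def by (rule the_equality) (use a inj_snd_perm in \<open>auto simp: inj_def\<close>)
  then show ?thesis using a inj_snd_perm by (auto simp: inj_def)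
qed

lemma fst_last_top: "fst p (last_top p) = CARD('a)"
  using last_top_eq_iff by blast

lemma snd_last_bot: "snd p (last_bot p) = CARD('a)"
  using last_bot_eq_iff by blast

lemma fst_vimage_image: "k \<le> CARD('a) \<Longrightarrow> fst p ` (fst p -` {1..k}) = {1..k}"
  using perm by (auto simp: is_perm_def bij_betw_def image_vimage_eq)

lemma snd_vimage_image: "k \<le> CARD('a) \<Longrightarrow> snd p ` (snd p -` {1..k}) = {1..k}"
  using perm by (auto simp: is_perm_def bij_betw_def image_vimage_eq)

lemma irreducibleD:
  assumes irr: "irreducible_perm p"
    and eq: "fst p -` {1..j} = snd p -` {1..k}" and "1 \<le> j" "j < CARD('a)" "k \<le> CARD('a)"
  shows False
proof -
  have "card (fst p -` {1..j}) = j"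
    using card_image[OF inj_on_subset[OF inj_fst_perm subset_UNIV], of "fst p -` {1..j}"]
    unfolding fst_vimage_image[OF less_imp_le[OF \<open>j < CARD('a)\<close>]] by simp
  moreover have "card (snd p -` {1..k}) = k"
    using card_image[OF inj_on_subset[OF inj_snd_perm subset_UNIV], of "snd p -` {1..k}"]
    unfolding snd_vimage_image[OF \<open>k \<le> CARD('a)\<close>] by simp
  ultimately have "j = k" using eq by simp
  then show False
    using irr eq \<open>1 \<le> j\<close> \<open>j < CARD('a)\<close> unfolding irreducible_perm_def by blast
qed

end

lemma is_perm_if_irreducible: "irreducible_perm p \<Longrightarrow> is_perm p"
  by (simp add: irreducible_perm_def)

lemma last_top_neq_last_bot:
  fixes p :: "'a::finite perm"
  assumes "irreducible_perm p" "CARD('a) \<ge> 2"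
  shows "last_top p \<noteq> last_bot p"
proof
  assume eq: "last_top p = last_bot p"
  note perm = is_perm_if_irreducible[OF assms(1)]
  have *: "fst p z = CARD('a) \<longleftrightarrow> snd p z = CARD('a)" for z
    using eq last_top_eq_iff[OF perm, of z] last_bot_eq_iff[OF perm, of z] by simp
  have "fst p -` {1..CARD('a) - 1} = snd p -` {1..CARD('a) - 1}"
  proof (rule set_eqI)
    fix z
    show "z \<in> fst p -` {1..CARD('a) - 1} \<longleftrightarrow> z \<in> snd p -` {1..CARD('a) - 1}"
      using *[of z] fst_perm_bounds[OF perm, of z] snd_perm_bounds[OF perm, of z] by auto
  qed
  then show False
    using irreducibleD[OF perm assms(1), of "CARD('a) - 1" "CARD('a) - 1"] assms(2) by force
qed

section \<open>Iterated top operations and the loops they close\<close>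

text \<open>Closed form of \<open>k\<close> top operations, for \<open>k\<close> up to the number
  \<open>CARD('a) - m\<close> of letters to the right of the winner in the bottom row: these letters
  rotate cyclically, the others stay.\<close>

definition rotate_bot :: "nat \<Rightarrow> 'a::finite perm \<Rightarrow> 'a perm" where
  "rotate_bot k p = (let m = snd p (last_top p) in
     (fst p, \<lambda>z. if snd p z \<le> m then snd p z
                 else if snd p z + k \<le> CARD('a) then snd p z + k
                 else snd p z + k - (CARD('a) - m)))"

lemma rotate_bot_0: "is_perm p \<Longrightarrow> rotate_bot 0 p = p"
  by (simp add: rotate_bot_def prod_eq_iff fun_eq_iff Let_def snd_perm_bounds(2))

lemma rotate_bot_full:
  fixes p :: "'a::finite perm"
  assumes "is_perm p"
  shows "rotate_bot (CARD('a) - snd p (last_top p)) p = p"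
  using snd_perm_bounds[OF assms]
  by (auto simp: rotate_bot_def prod_eq_iff fun_eq_iff Let_def)

lemma last_bot_rotate_bot:
  fixes p :: "'a::finite perm"
  assumes "is_perm p" "snd p z + k = CARD('a)" "snd p (last_top p) < snd p z"
  shows "last_bot (rotate_bot k p) = z"
  unfolding last_bot_def
proof (rule the_equality)
  show "snd (rotate_bot k p) z = CARD('a)"
    using assms by (auto simp: rotate_bot_def Let_def)
  fix y assume y: "snd (rotate_bot k p) y = CARD('a)"
  note b = snd_perm_bounds[OF assms(1)]
  have "snd p y = snd p z"
    using y assms(2,3) b[of y] b[of z]
    by (auto simp: rotate_bot_def Let_def split: if_splits)
  then show "y = z" using inj_snd_perm[OF assms(1)] by (auto simp: inj_def)
qed

lemma last_top_rotate_bot: "last_top (rotate_bot k p) = last_top p"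
  by (simp add: last_top_def rotate_bot_def Let_def)

lemma rauzy_step_rotate_bot:
  fixes p :: "'a::finite perm"
  assumes perm: "is_perm p" and k: "snd p (last_top p) + k < CARD('a)"
  shows "rauzy_step TopOp (rotate_bot k p) = rotate_bot (Suc k) p"
    and "theta_arrow TopOp (rotate_bot k p) v =
      v + v $ last_top p *\<^sub>R axis (THE z. snd p z + k = CARD('a)) 1"
proof -
  define m where "m = snd p (last_top p)"
  note b = snd_perm_bounds[OF perm]
  have "CARD('a) - k \<in> snd p ` UNIV"
    using perm k by (auto simp: is_perm_def bij_betw_def)
  then obtain z where "snd p z = CARD('a) - k" by (metis imageE)
  then have z: "snd p z + k = CARD('a)" using k by simp
  have uniq: "y = z" if "snd p y + k = CARD('a)" for y
    using that z inj_snd_perm[OF perm] by (metis add_right_cancel injD)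
  have mz: "m < snd p z" using z k by (simp add: m_def)
  have lb: "last_bot (rotate_bot k p) = z"
    using last_bot_rotate_bot[OF perm z] mz by (simp add: m_def)
  have the: "(THE z. snd p z + k = CARD('a)) = z"
    using z uniq by (rule the_equality)
  show "theta_arrow TopOp (rotate_bot k p) v =
      v + v $ last_top p *\<^sub>R axis (THE z. snd p z + k = CARD('a)) 1"
    by (simp add: theta_arrow_def winner_def loser_def last_top_rotate_bot lb the)
  have snd_rot: "snd (rotate_bot i p) y = (if snd p y \<le> m then snd p y
      else if snd p y + i \<le> CARD('a) then snd p y + i else snd p y + i - (CARD('a) - m))" for i y
    by (simp add: rotate_bot_def m_def Let_def)
  have snd_step: "snd (rauzy_step TopOp (rotate_bot k p)) y = (if y = z then m + 1
      else if m < snd (rotate_bot k p) y then snd (rotate_bot k p) y + 1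
      else snd (rotate_bot k p) y)" for y
    by (simp add: rauzy_step_def Let_def last_top_rotate_bot lb snd_rot m_def)
  have "snd (rauzy_step TopOp (rotate_bot k p)) y = snd (rotate_bot (Suc k) p) y" for y
  proof (cases "y = z")
    case True
    then show ?thesis
      using z mz k unfolding snd_step snd_rot by simp
  next
    case False
    then have "snd p y + k \<noteq> CARD('a)" using uniq by blast
    then show ?thesis
      using z mz k False b[of y] unfolding snd_step snd_rot m_def by simp linarith
  qed
  moreover have "fst (rauzy_step TopOp (rotate_bot k p)) = fst (rotate_bot (Suc k) p)"
    by (simp add: rauzy_step_def Let_def rotate_bot_def)
  ultimately show "rauzy_step TopOp (rotate_bot k p) = rotate_bot (Suc k) p"
    by (intro prod_eqI ext) auto
qed

lemma path_end_append: "path_end p (ts @ ts') = path_end (path_end p ts) ts'"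
  by (induction ts arbitrary: p) auto

lemma theta_path_append: "theta_path p (ts @ ts') = theta_path (path_end p ts) ts' \<circ> theta_path p ts"
  by (induction ts arbitrary: p) (auto simp: o_assoc)

text \<open>Each step has a different loser, taken from right to left in the original bottom row,
  and the winner itself never loses. Its coordinate is therefore constant, and the axes of the
  losers add up to an indicator vector.\<close>

lemma path_replicate_TopOp:
  fixes p :: "'a::finite perm"
  assumes "is_perm p" "snd p (last_top p) + k \<le> CARD('a)"
  shows "path_end p (replicate k TopOp) = rotate_bot k p \<and>
    theta_path p (replicate k TopOp) v =
      v + v $ last_top p *\<^sub>R (\<chi> z. if CARD('a) < snd p z + k then 1 else 0)"
  using assms(2)
proof (induction k)
  case 0
  have "(\<chi> z. if CARD('a) < snd p z + 0 then 1 else 0) = (0 :: real^'a)"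
    using snd_perm_bounds(2)[OF assms(1)] by (auto simp: vec_eq_iff not_less)
  then show ?case by (simp add: rotate_bot_0[OF assms(1)])
next
  case (Suc k)
  let ?s = "\<lambda>k. (\<chi> z. if CARD('a) < snd p z + k then 1 else 0) :: real^'a"
  have k: "snd p (last_top p) + k < CARD('a)" using Suc.prems by simp
  have IH: "path_end p (replicate k TopOp) = rotate_bot k p"
    "theta_path p (replicate k TopOp) v = v + v $ last_top p *\<^sub>R ?s k"
    using Suc by auto
  have rep: "replicate (Suc k) TopOp = replicate k TopOp @ [TopOp]"
    by (simp add: replicate_append_same)
  note step = rauzy_step_rotate_bot[OF assms(1) k]
  have "CARD('a) - k \<in> snd p ` UNIV"
    using assms(1) k by (auto simp: is_perm_def bij_betw_def)
  then obtain z where "snd p z = CARD('a) - k" by (metis imageE)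
  then have z: "snd p z + k = CARD('a)" using k by simp
  have uniq: "snd p y + k = CARD('a) \<longleftrightarrow> y = z" for y
    using z inj_snd_perm[OF assms(1)] by (metis add_right_cancel injD)
  have the: "(THE z. snd p z + k = CARD('a)) = z"
    by (simp add: uniq)
  have s: "?s k + axis z 1 = ?s (Suc k)"
  proof (rule vec_eq_iff[THEN iffD2], rule allI)
    fix i
    show "(?s k + axis z 1) $ i = ?s (Suc k) $ i"
      using uniq[of i] by (cases "i = z") (auto simp: axis_def)
  qed
  have "?s k $ last_top p = 0" using k by simp
  then have "theta_path p (replicate (Suc k) TopOp) v = v + v $ last_top p *\<^sub>R (?s k + axis z 1)"
    unfolding rep theta_path_append using IH step(2) by (simp add: the scaleR_add_right)
  then show ?case
    unfolding s unfolding rep path_end_append using IH(1) step(1) by simp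
qed

lemma path_end_replicate_BotOp:
  "path_end p (replicate n BotOp) = prod.swap (path_end (prod.swap p) (replicate n TopOp))"
  by (induction n arbitrary: p) (auto simp: rauzy_step_BotOp)

lemma theta_path_replicate_BotOp:
  "theta_path p (replicate n BotOp) = theta_path (prod.swap p) (replicate n TopOp)"
  by (induction n arbitrary: p) (auto simp: rauzy_step_BotOp theta_arrow_BotOp)

text \<open>A full rotation closes the loop. The winner is last in its own row, so the letters to
  its right in the other row, each losing once, are exactly those with a nonzero entry in the image
  of its axis under \<open>Omega p\<close>. Exchanging the rows changes the sign of
  \<open>Omega\<close>, whence the -1.\<close>

lemma ex_rauzy_loop:
  fixes p :: "'a::finite perm"
  assumes irr: "irreducible_perm p" and card: "CARD('a) \<ge> 2"
  shows "\<exists>n>0. path_end p (replicate n t) = p \<and>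
    theta_path p (replicate n t) = (\<lambda>v. v + (case t of TopOp \<Rightarrow> 1 | BotOp \<Rightarrow> -1) *\<^sub>R
      v $ winner t p *\<^sub>R Omega p (axis (winner t p) 1))"
proof -
  have top: "\<exists>n>0. path_end q (replicate n TopOp) = q \<and>
      theta_path q (replicate n TopOp) = (\<lambda>v. v + v $ last_top q *\<^sub>R Omega q (axis (last_top q) 1))"
    if q: "irreducible_perm q" for q :: "'a perm"
  proof -
    note perm = is_perm_if_irreducible[OF q]
    define n where "n = CARD('a) - snd q (last_top q)"
    have "snd q (last_top q) < CARD('a)"
      using last_top_neq_last_bot[OF q card] last_bot_eq_iff[OF perm, of "last_top q"]
        snd_perm_bounds(2)[OF perm, of "last_top q"] by (auto simp: order.strict_iff_order)
    then have n: "n > 0" "snd q (last_top q) + n = CARD('a)" by (auto simp: n_def)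
    have "(\<chi> z. if CARD('a) < snd q z + n then 1 else 0) = Omega q (axis (last_top q) 1)"
    proof (rule vec_eq_iff[THEN iffD2], rule allI)
      fix z
      have "z = last_top q" if "fst q z = CARD('a)"
        using that last_top_eq_iff[OF perm, of z] by auto
      then show "(\<chi> z. if CARD('a) < snd q z + n then 1 else 0) $ z =
          Omega q (axis (last_top q) 1) $ z"
        using n fst_last_top[OF perm] fst_perm_bounds(2)[OF perm, of z]
        by (auto simp: Omega_axis omega_entry_def)
    qed
    then show ?thesis
      using n path_replicate_TopOp[OF perm, of n] rotate_bot_full[OF perm] n_def
      by (intro exI[of _ n]) (auto simp: fun_eq_iff)
  qed
  show ?thesis
  proof (cases t)
    case TopOp
    then show ?thesis using top[OF irr] by (simp add: winner_def)
  next
    case BotOp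
    obtain n where n: "n > 0" "path_end (prod.swap p) (replicate n TopOp) = prod.swap p"
      "theta_path (prod.swap p) (replicate n TopOp) = (\<lambda>v. v + v $ last_top (prod.swap p) *\<^sub>R
         Omega (prod.swap p) (axis (last_top (prod.swap p)) 1))"
      using top[of "prod.swap p"] irr by (auto simp: irreducible_perm_swap)
    have "path_end p (replicate n BotOp) = p"
      unfolding path_end_replicate_BotOp n(2) by simp
    moreover have "theta_path p (replicate n BotOp) =
        (\<lambda>v. v + (-1) *\<^sub>R v $ last_bot p *\<^sub>R Omega p (axis (last_bot p) 1))"
      unfolding theta_path_replicate_BotOp n(3) last_top_swap Omega_swap by simp
    ultimately show ?thesis
      using n(1) BotOp by (intro exI[of _ n]) (simp add: winner_def)
  qed
qed

section \<open>Effect of one arrow on \<open>Omega\<close> and on irreducibility\<close>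

lemma rauzy_step_nonloser:
  assumes "z \<noteq> loser t p" "y \<noteq> loser t p"
  shows "fst (rauzy_step t p) z < fst (rauzy_step t p) y \<longleftrightarrow> fst p z < fst p y"
    and "snd (rauzy_step t p) z < snd (rauzy_step t p) y \<longleftrightarrow> snd p z < snd p y"
  using assms by (cases t; simp add: rauzy_step_def Let_def loser_def)+

text \<open>A fragment of the relation \<Theta> \<Omega>(\<pi>) \<Theta>* = \<Omega>(\<pi>') for an
  arrow from \<pi> to \<pi>', since the transpose \<Theta>* fixes the axes of all letters but the
  loser. Concretely, only the loser's coordinate changes, and its new value is the sum of the old
  values at loser and winner.\<close>

lemma theta_arrow_Omega_axis:
  fixes p :: "'a::finite perm"
  assumes irr: "irreducible_perm p" and card: "CARD('a) \<ge> 2" and z: "z \<noteq> loser t p"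
  shows "theta_arrow t p (Omega p (axis z 1)) = Omega (rauzy_step t p) (axis z 1)"
proof -
  have top: "theta_arrow TopOp q (Omega q (axis z 1)) = Omega (rauzy_step TopOp q) (axis z 1)"
    if q: "irreducible_perm q" and z: "z \<noteq> last_bot q" for q :: "'a perm"
  proof (rule vec_eq_iff[THEN iffD2], rule allI)
    fix y
    note perm = is_perm_if_irreducible[OF q]
    note neq = last_top_neq_last_bot[OF q card]
    note lt = fst_last_top[OF perm] and lb = snd_last_bot[OF perm]
    have 1: "fst q a = CARD('a) \<longleftrightarrow> a = last_top q" "snd q a = CARD('a) \<longleftrightarrow> a = last_bot q"
      "fst q a \<le> CARD('a)" "snd q a \<le> CARD('a)" for a
      using last_top_eq_iff[OF perm, of a] last_bot_eq_iff[OF perm, of a]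
        fst_perm_bounds(2)[OF perm, of a] snd_perm_bounds(2)[OF perm, of a] by auto
    have 2: "snd q a = snd q b \<longleftrightarrow> a = b" for a b
      using inj_snd_perm[OF perm] by (auto simp: inj_def)
    show "theta_arrow TopOp q (Omega q (axis z 1)) $ y = Omega (rauzy_step TopOp q) (axis z 1) $ y"
    proof (cases "y = last_bot q")
      case False
      then have "axis (last_bot q) (1::real) $ y = 0" by (simp add: axis_def)
      then show ?thesis
        using z False rauzy_step_nonloser[of z TopOp q y]
          rauzy_step_nonloser[of y TopOp q z]
        by (simp add: theta_arrow_def Omega_axis omega_entry_def loser_def winner_def)
    next
      case True
      have "fst q z < CARD('a) \<or> z = last_top q" "snd q z < CARD('a)"
        "fst q y < CARD('a)" "snd q (last_top q) < CARD('a)"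
        using 1[of z] 1[of y] 1[of "last_top q"] z True neq by (auto simp: order.strict_iff_order)
      moreover have "fst q z \<noteq> fst q y"
        using inj_fst_perm[OF perm] z True by (auto simp: inj_def)
      ultimately show ?thesis
        using z neq True 2[of z "last_top q"] lt lb
        by (auto simp: theta_arrow_def Omega_axis omega_entry_def loser_def winner_def
            rauzy_step_def Let_def)
    qed
  qed
  show ?thesis
  proof (cases t)
    case TopOp
    then show ?thesis using top[OF irr] z by (simp add: loser_def)
  next
    case BotOp
    have "theta_arrow BotOp p (- v) = - theta_arrow BotOp p v" for v
      by (simp add: theta_arrow_def)
    moreover have "z \<noteq> last_bot (prod.swap p)"
      using z BotOp by (simp add: loser_def last_bot_swap)
    ultimately have "- theta_arrow BotOp p (Omega p (axis z 1)) =
        - Omega (rauzy_step BotOp p) (axis z 1)"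
      using top[of "prod.swap p"] irr
      by (simp add: irreducible_perm_swap rauzy_step_BotOp theta_arrow_BotOp Omega_swap)
    then show ?thesis using BotOp by simp
  qed
qed

lemma is_perm_rauzy_step_TopOp:
  fixes p :: "'a::finite perm"
  assumes irr: "irreducible_perm p" and card: "CARD('a) \<ge> 2"
  shows "is_perm (rauzy_step TopOp p)"
proof -
  note perm = is_perm_if_irreducible[OF irr]
  let ?f = "snd (rauzy_step TopOp p)"
  have m: "snd p (last_top p) < CARD('a)"
    using last_top_neq_last_bot[OF irr card] last_bot_eq_iff[OF perm, of "last_top p"]
      snd_perm_bounds(2)[OF perm, of "last_top p"] by (auto simp: order.strict_iff_order)
  have f: "?f z = (if z = last_bot p then snd p (last_top p) + 1
      else if snd p z > snd p (last_top p) then snd p z + 1 else snd p z)" for z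
    by (simp add: rauzy_step_def Let_def)
  have eq: "snd p a = snd p b \<longleftrightarrow> a = b" for a b
    using inj_snd_perm[OF perm] by (auto simp: inj_def)
  have inj: "inj ?f"
  proof (rule injI)
    fix a b assume "?f a = ?f b"
    then show "a = b"
      unfolding f by (auto split: if_splits simp: eq)
  qed
  have "?f z \<in> {1..CARD('a)}" for z
  proof -
    have "z = last_bot p \<or> snd p z < CARD('a)"
      using last_bot_eq_iff[OF perm, of z] snd_perm_bounds(2)[OF perm, of z] by auto
    then show ?thesis
      using snd_perm_bounds(1)[OF perm, of z] m unfolding f by auto
  qed
  then have "?f ` UNIV \<subseteq> {1..CARD('a)}" by blast
  then have "?f ` UNIV = {1..CARD('a)}"
    by (rule card_subset_eq[rotated]) (simp_all add: card_image[OF inj])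
  moreover have "fst (rauzy_step TopOp p) = fst p"
    by (simp add: rauzy_step_def Let_def)
  ultimately show ?thesis
    using perm inj by (simp add: is_perm_def bij_betw_def)
qed

text \<open>A common proper prefix of the new rows misses the last top letter, hence ends to the
  left of that letter in the bottom row. There a top operation changes nothing, so the old rows
  would have the same common prefix.\<close>

lemma irreducible_rauzy_step:
  fixes p :: "'a::finite perm"
  assumes irr: "irreducible_perm p" and card: "CARD('a) \<ge> 2"
  shows "irreducible_perm (rauzy_step t p)"
proof -
  have top: "irreducible_perm (rauzy_step TopOp q)" if q: "irreducible_perm q" for q :: "'a perm"
  proof -
    note perm = is_perm_if_irreducible[OF q]
    note perm' = is_perm_rauzy_step_TopOp[OF q card]
    have fst: "fst (rauzy_step TopOp q) = fst q"
      by (simp add: rauzy_step_def Let_def)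
    have snd: "snd (rauzy_step TopOp q) z = (if z = last_bot q then snd q (last_top q) + 1
        else if snd q z > snd q (last_top q) then snd q z + 1 else snd q z)" for z
      by (simp add: rauzy_step_def Let_def)
    have False if k: "1 \<le> k" "k < CARD('a)"
      and eq: "fst q -` {1..k} = snd (rauzy_step TopOp q) -` {1..k}" for k
    proof -
      have "last_top q \<notin> fst q -` {1..k}"
        using fst_last_top[OF perm] k by simp
      then have "last_top q \<notin> snd (rauzy_step TopOp q) -` {1..k}"
        by (simp only: eq not_False_eq_True)
      then have *: "k < snd q (last_top q)"
        using snd_perm_bounds(1)[OF perm, of "last_top q"] last_top_neq_last_bot[OF q card]
        by (simp add: snd)
      have "z \<in> snd q -` {1..k} \<longleftrightarrow> z \<in> snd (rauzy_step TopOp q) -` {1..k}" for z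
        using * k snd_last_bot[OF perm] by (auto simp: snd)
      then have "snd (rauzy_step TopOp q) -` {1..k} = snd q -` {1..k}" by blast
      then show False
        using irreducibleD[OF perm q, of k k] eq k by simp
    qed
    then show ?thesis
      using perm' fst unfolding irreducible_perm_def by auto
  qed
  show ?thesis
  proof (cases t)
    case TopOp
    then show ?thesis using top[OF irr] by simp
  next
    case BotOp
    then show ?thesis
      using top[of "prod.swap p"] irr
      by (simp add: rauzy_step_BotOp irreducible_perm_swap)
  qed
qed

section \<open>Paths back to the start and paths to a given letter\<close>

lemma irreducible_path_end:
  fixes p :: "'a::finite perm"
  assumes "irreducible_perm p" "CARD('a) \<ge> 2"
  shows "irreducible_perm (path_end p ts)"
  using assms(1) by (induction ts arbitrary: p) (simp_all add: irreducible_rauzy_step[OF _ assms(2)])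

text \<open>Every arrow lies on a loop of arrows of its own type, and the rest of that loop undoes
  it.\<close>

lemma ex_return_path:
  fixes p :: "'a::finite perm"
  assumes "irreducible_perm p" "CARD('a) \<ge> 2"
  shows "\<exists>ts'. path_end (path_end p ts) ts' = p"
  using assms(1)
proof (induction ts arbitrary: p)
  case Nil
  show ?case by (intro exI[of _ "[]"]) simp
next
  case (Cons t ts)
  obtain ts' where ts': "path_end (path_end (rauzy_step t p) ts) ts' = rauzy_step t p"
    using Cons.IH irreducible_rauzy_step[OF Cons.prems assms(2)] by blast
  obtain n where "n > 0" and n: "path_end p (replicate n t) = p"
    using ex_rauzy_loop[OF Cons.prems assms(2)] by blast
  then obtain m where "n = Suc m" using gr0_implies_Suc by blast
  then have "path_end (path_end p (t # ts)) (ts' @ replicate m t) = p"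
    using n ts' by (simp add: path_end_append)
  then show ?case by blast
qed

text \<open>A letter that is never last never moves. If such letters exist, they fill an initial segment
  of both rows.\<close>

lemma ex_path_to_last:
  fixes p :: "'a::finite perm"
  assumes irr: "irreducible_perm p" and card: "CARD('a) \<ge> 2"
  shows "\<exists>ts. w \<in> {last_top (path_end p ts), last_bot (path_end p ts)}"
proof (rule ccontr)
  assume contr: "\<not> ?thesis"
  define N where "N = {z. \<forall>ts. z \<notin> {last_top (path_end p ts), last_bot (path_end p ts)}}"
  have "w \<in> N" using contr by (auto simp: N_def)
  note perm = is_perm_if_irreducible[OF irr]
  note irr' = irreducible_path_end[OF irr card]
  note perm' = is_perm_if_irreducible[OF irr']
  have step: "rauzy_step t (path_end p ts) = path_end p (ts @ [t])" for t ts
    by (simp add: path_end_append)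
  \<comment> \<open>Top operations would rotate a letter standing to the right of the top winner to
    the end of the bottom row.\<close>
  have bot: "snd (path_end p ts) z < snd (path_end p ts) (last_top (path_end p ts))"
    if "z \<in> N" for z ts
  proof (rule ccontr)
    let ?q = "path_end p ts"
    have nl: "last_top (path_end p ts) \<noteq> z" "last_bot (path_end p ts) \<noteq> z" for ts
      using that by (auto simp: N_def)
    assume "\<not> ?thesis"
    moreover have "z \<noteq> last_top ?q" using nl by blast
    then have "snd ?q z \<noteq> snd ?q (last_top ?q)"
      using inj_snd_perm[OF perm'[of ts]] by (auto simp: inj_def)
    ultimately have less: "snd ?q (last_top ?q) < snd ?q z" by simp
    have le: "snd ?q z \<le> CARD('a)" using snd_perm_bounds(2)[OF perm'[of ts]] .
    then have "last_bot (rotate_bot (CARD('a) - snd ?q z) ?q) = z"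
      using less by (intro last_bot_rotate_bot[OF perm'[of ts]]) auto
    moreover have "path_end ?q (replicate (CARD('a) - snd ?q z) TopOp) =
        rotate_bot (CARD('a) - snd ?q z) ?q"
      using path_replicate_TopOp[OF perm'[of ts], of "CARD('a) - snd ?q z"] less le by simp
    ultimately have "last_bot (path_end p (ts @ replicate (CARD('a) - snd ?q z) TopOp)) = z"
      by (simp add: path_end_append)
    then show False using nl by blast
  qed
  have top: "fst (path_end p ts) z < fst (path_end p ts) (last_bot (path_end p ts))"
    if "z \<in> N" for z ts
  proof (rule ccontr)
    let ?q = "prod.swap (path_end p ts)"
    have perm_q: "is_perm ?q" unfolding is_perm_swap by (rule perm')
    have nl: "last_top (path_end p ts) \<noteq> z" "last_bot (path_end p ts) \<noteq> z" for ts
      using that by (auto simp: N_def)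
    assume "\<not> ?thesis"
    moreover have "z \<noteq> last_top ?q" using nl(2)[of ts] by (simp add: last_top_swap)
    then have "snd ?q z \<noteq> snd ?q (last_top ?q)"
      using inj_snd_perm[OF perm_q] by (auto simp: inj_def)
    ultimately have less: "snd ?q (last_top ?q) < snd ?q z" by (simp add: last_top_swap)
    have le: "snd ?q z \<le> CARD('a)" using snd_perm_bounds(2)[OF perm_q] .
    then have "last_bot (rotate_bot (CARD('a) - snd ?q z) ?q) = z"
      using less by (intro last_bot_rotate_bot[OF perm_q]) auto
    moreover have "path_end ?q (replicate (CARD('a) - snd ?q z) TopOp) =
        rotate_bot (CARD('a) - snd ?q z) ?q"
      using path_replicate_TopOp[OF perm_q, of "CARD('a) - snd ?q z"] less le by simp
    ultimately have "last_top (path_end p (ts @ replicate (CARD('a) - snd ?q z) BotOp)) = z"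
      by (simp only: path_end_append path_end_replicate_BotOp last_top_swap)
    then show False using nl by blast
  qed
  have "finite N" by simp
  have "Max (fst p ` N) \<in> fst p ` N"
    by (rule Max_in) (use \<open>w \<in> N\<close> in auto)
  then obtain a where a1: "a \<in> N" "Max (fst p ` N) = fst p a" by (rule imageE) blast
  have a: "a \<in> N" "\<And>z. z \<in> N \<Longrightarrow> fst p z \<le> fst p a"
    using a1(1) Max_ge[OF finite_imageI[OF \<open>finite N\<close>, of "fst p"] imageI, unfolded a1(2)] by blast+
  have "Max (snd p ` N) \<in> snd p ` N"
    by (rule Max_in) (use \<open>w \<in> N\<close> in auto)
  then obtain b where b1: "b \<in> N" "Max (snd p ` N) = snd p b" by (rule imageE) blast
  have b: "b \<in> N" "\<And>z. z \<in> N \<Longrightarrow> snd p z \<le> snd p b"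
    using b1(1) Max_ge[OF finite_imageI[OF \<open>finite N\<close>, of "snd p"] imageI, unfolded b1(2)] by blast+
  \<comment> \<open>The top row changes only to the right of \<open>last_bot\<close>, which by
    \<open>top\<close> is to the right of \<open>a\<close>. The segment up to \<open>a\<close> is
    therefore frozen.\<close>
  have fst_const: "\<forall>r. fst p r \<le> fst p a \<longrightarrow> fst (path_end p ts) r = fst p r" for ts
  proof (induction ts rule: rev_induct)
    case (snoc t ts)
    let ?q = "path_end p ts"
    have "fst ?q a < fst ?q (last_bot ?q)" by (rule top[OF a(1)])
    moreover have "fst ?q (last_bot ?q) \<le> CARD('a)" by (rule fst_perm_bounds(2)[OF perm'])
    ultimately have step_const: "fst (rauzy_step t ?q) r = fst ?q r" if "fst ?q r \<le> fst ?q a" for r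
      using that fst_last_top[OF perm', of ts] by (cases t) (auto simp: rauzy_step_def Let_def)
    show ?case
    proof (intro allI impI)
      fix r assume r: "fst p r \<le> fst p a"
      then have "fst ?q r = fst p r" "fst ?q a = fst p a" using snoc.IH by blast+
      then show "fst (path_end p (ts @ [t])) r = fst p r"
        using step_const[of r] r by (simp add: path_end_append)
    qed
  qed simp
  have snd_const: "\<forall>r. snd p r \<le> snd p b \<longrightarrow> snd (path_end p ts) r = snd p r" for ts
  proof (induction ts rule: rev_induct)
    case (snoc t ts)
    let ?q = "path_end p ts"
    have "snd ?q b < snd ?q (last_top ?q)" by (rule bot[OF b(1)])
    moreover have "snd ?q (last_top ?q) \<le> CARD('a)" by (rule snd_perm_bounds(2)[OF perm'])
    ultimately have step_const: "snd (rauzy_step t ?q) r = snd ?q r" if "snd ?q r \<le> snd ?q b" for r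
      using that snd_last_bot[OF perm', of ts] by (cases t) (auto simp: rauzy_step_def Let_def)
    show ?case
    proof (intro allI impI)
      fix r assume r: "snd p r \<le> snd p b"
      then have "snd ?q r = snd p r" "snd ?q b = snd p b" using snoc.IH by blast+
      then show "snd (path_end p (ts @ [t])) r = snd p r"
        using step_const[of r] r by (simp add: path_end_append)
    qed
  qed simp
  \<comment> \<open>Frozen at or before \<open>a\<close>, the letter \<open>r\<close> stays strictly
    to the left of \<open>last_bot\<close> in the top row, so it is neither that letter nor the last
    one.\<close>
  have "r \<in> N" if r: "fst p r \<le> fst p a" for r
  proof (rule ccontr)
    assume "r \<notin> N"
    then obtain ts where ts: "r \<in> {last_top (path_end p ts), last_bot (path_end p ts)}"
      by (auto simp: N_def)
    have "fst (path_end p ts) r \<le> fst (path_end p ts) a"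
      using fst_const[of ts] r by simp
    also have "\<dots> < fst (path_end p ts) (last_bot (path_end p ts))" by (rule top[OF a(1)])
    finally show False
      using ts fst_last_top[OF perm', of ts]
        fst_perm_bounds(2)[OF perm', of ts "last_bot (path_end p ts)"] by auto
  qed
  then have Na: "N = fst p -` {1..fst p a}"
    using a(2) fst_perm_bounds(1)[OF perm] by (intro set_eqI iffI) simp_all
  have "r \<in> N" if r: "snd p r \<le> snd p b" for r
  proof (rule ccontr)
    assume "r \<notin> N"
    then obtain ts where ts: "r \<in> {last_top (path_end p ts), last_bot (path_end p ts)}"
      by (auto simp: N_def)
    have "snd (path_end p ts) r \<le> snd (path_end p ts) b"
      using snd_const[of ts] r by simp
    also have "\<dots> < snd (path_end p ts) (last_top (path_end p ts))" by (rule bot[OF b(1)])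
    finally show False
      using ts snd_last_bot[OF perm', of ts]
        snd_perm_bounds(2)[OF perm', of ts "last_top (path_end p ts)"] by auto
  qed
  then have Nb: "N = snd p -` {1..snd p b}"
    using b(2) snd_perm_bounds(1)[OF perm] by (intro set_eqI iffI) simp_all
  have "fst p a < CARD('a)"
    using top[OF a(1), of "[]"] fst_perm_bounds(2)[OF perm, of "last_bot p"] by simp
  show False
    by (rule irreducibleD[OF perm irr trans[OF Na[symmetric] Nb]
          fst_perm_bounds(1)[OF perm] \<open>fst p a < CARD('a)\<close> snd_perm_bounds(2)[OF perm]])
qed

text \<open>The path \<gamma> that moves \<open>w\<close> to the end of a row is in general no loop
  and acts on no flags by itself. Instead two loops with the same outer parts \<gamma> and \<delta>
  are compared; they differ by a transvection. Its sign \<sigma> tells in which row \<open>w\<close>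
  has become last.\<close>

lemma ex_rauzy_transvection:
  fixes p :: "'a::finite perm"
  assumes irr: "irreducible_perm p" and card: "CARD('a) \<ge> 2"
  obtains \<gamma> \<delta> \<eta> \<sigma> where "\<gamma> @ \<delta> \<in> rauzy_monoid p" "\<gamma> @ \<eta> @ \<delta> \<in> rauzy_monoid p" "\<sigma> \<in> {1, -1}"
    "theta_path p (\<gamma> @ \<eta> @ \<delta>) =
      theta_path p (\<gamma> @ \<delta>) \<circ> (\<lambda>v. v + \<sigma> *\<^sub>R v $ w *\<^sub>R Omega p (axis w 1))"
proof -
  define last where "last q \<longleftrightarrow> w \<in> {last_top q, last_bot q}" for q :: "'a perm"
  obtain ts where "last (path_end p ts)"
    using ex_path_to_last[OF irr card] by (auto simp: last_def)
  \<comment> \<open>The path is cut where \<open>w\<close> is last for the first time. Up to there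
    each arrow preserves the coordinate \<open>w\<close> and carries the image of
    \<open>axis w 1\<close> under one \<open>Omega\<close> to the next, so the conjugated loop is
    again a transvection in the same form at \<open>p\<close>.\<close>
  then have "\<exists>\<gamma>. last (path_end p \<gamma>) \<and> (\<forall>v. theta_path p \<gamma> v $ w = v $ w) \<and>
      theta_path p \<gamma> (Omega p (axis w 1)) = Omega (path_end p \<gamma>) (axis w 1) \<and> linear (theta_path p \<gamma>)"
    using irr
  proof (induction ts arbitrary: p)
    case Nil
    then show ?case by (intro exI[of _ "[]"]) (auto simp: linear_ident)
  next
    case (Cons t ts)
    show ?case
    proof (cases "last p")
      case True
      then show ?thesis by (intro exI[of _ "[]"]) (auto simp: linear_ident)
    next
      case False
      then have w: "w \<noteq> loser t p"
        by (cases t) (auto simp: last_def loser_def)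
      obtain \<gamma> where \<gamma>: "last (path_end (rauzy_step t p) \<gamma>)"
        "\<forall>v. theta_path (rauzy_step t p) \<gamma> v $ w = v $ w"
        "theta_path (rauzy_step t p) \<gamma> (Omega (rauzy_step t p) (axis w 1)) =
          Omega (path_end (rauzy_step t p) \<gamma>) (axis w 1)" "linear (theta_path (rauzy_step t p) \<gamma>)"
        using Cons.IH[OF _ irreducible_rauzy_step[OF Cons.prems(2) card]] Cons.prems by auto
      have "linear (theta_arrow t p)"
        unfolding theta_arrow_def by (rule linearI) (auto simp: algebra_simps)
      moreover have "theta_arrow t p v $ w = v $ w" for v
        using w by (simp add: theta_arrow_def axis_def)
      ultimately show ?thesis
        using \<gamma> theta_arrow_Omega_axis[OF Cons.prems(2) card w]
        by (intro exI[of _ "t # \<gamma>"]) (auto intro: linear_compose[unfolded o_def])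
    qed
  qed
  then obtain \<gamma> where \<gamma>: "last (path_end p \<gamma>)" "\<And>v. theta_path p \<gamma> v $ w = v $ w"
      "theta_path p \<gamma> (Omega p (axis w 1)) = Omega (path_end p \<gamma>) (axis w 1)"
      "linear (theta_path p \<gamma>)"
    by blast
  define q where "q = path_end p \<gamma>"
  obtain \<delta> where \<delta>: "path_end q \<delta> = p"
    using ex_return_path[OF irr card] q_def by blast
  obtain t where t: "w = winner t q"
    using \<gamma>(1) by (auto simp: last_def q_def winner_def intro: that[of TopOp] that[of BotOp])
  obtain n where n: "path_end q (replicate n t) = q"
    "theta_path q (replicate n t) = (\<lambda>v. v + (case t of TopOp \<Rightarrow> 1 | BotOp \<Rightarrow> -1) *\<^sub>R
      v $ w *\<^sub>R Omega q (axis w 1))"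
    using ex_rauzy_loop[OF irreducible_path_end[OF irr card] card, of \<gamma> t]
    unfolding q_def[symmetric] t[symmetric] by blast
  show ?thesis
  proof (rule that[of \<gamma> \<delta> "replicate n t" "case t of TopOp \<Rightarrow> 1 | BotOp \<Rightarrow> -1"])
    show "theta_path p (\<gamma> @ replicate n t @ \<delta>) = theta_path p (\<gamma> @ \<delta>) \<circ>
        (\<lambda>v. v + (case t of TopOp \<Rightarrow> 1 | BotOp \<Rightarrow> -1) *\<^sub>R v $ w *\<^sub>R Omega p (axis w 1))"
      using n \<gamma>(2,3)
      by (auto simp: fun_eq_iff theta_path_append q_def linear_add[OF \<gamma>(4)] linear_scale[OF \<gamma>(4)])
  qed (use n \<delta> in \<open>auto simp: rauzy_monoid_def path_end_append q_def split: rauzy_op.split\<close>)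
qed

text \<open>Connectedness of the graph on the letters whose edges are the nonzero entries. Without
  an edge leaving \<open>B\<close>, a letter of \<open>B\<close> and one outside are in the same
  order in both rows. The letters before the first one of the complement then form the same prefix
  in both rows.\<close>

lemma ex_omega_entry_across:
  fixes p :: "'a::finite perm"
  assumes irr: "irreducible_perm p" and "B \<noteq> {}" "B \<noteq> UNIV"
  shows "\<exists>w\<in>B. \<exists>z. z \<notin> B \<and> omega_entry p w z \<noteq> 0"
proof (rule ccontr)
  assume contr: "\<not> ?thesis"
  note perm = is_perm_if_irreducible[OF irr]
  have "1 \<in> fst p ` UNIV"
    using perm by (auto simp: is_perm_def bij_betw_def Suc_le_eq)
  then obtain a where a: "fst p a = 1" by (metis imageE)
  \<comment> \<open>The side that contains the first top letter, so that the common prefix found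
    below is nonempty.\<close>
  define B' where "B' = (if a \<in> B then B else - B)"
  have B': "a \<in> B'" "- B' \<noteq> {}" using assms by (auto simp: B'_def)
  have noedge: "fst p w < fst p z \<longleftrightarrow> snd p w < snd p z" if "w \<in> B'" "z \<notin> B'" for w z
  proof -
    have "omega_entry p w z = 0"
    proof (cases "a \<in> B")
      case True
      then show ?thesis using that contr by (auto simp: B'_def)
    next
      case False
      then have "omega_entry p z w = 0" using that contr by (auto simp: B'_def)
      then show ?thesis by (subst omega_entry_antisym) simp
    qed
    moreover have "w \<noteq> z" using that by auto
    then have "fst p w \<noteq> fst p z" "snd p w \<noteq> snd p z"
      using inj_fst_perm[OF perm] inj_snd_perm[OF perm] by (auto simp: inj_def)
    ultimately show ?thesis by (auto simp: omega_entry_def split: if_splits)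
  qed
  obtain z where z: "z \<notin> B'" "\<And>y. y \<notin> B' \<Longrightarrow> fst p z \<le> fst p y"
    using B'(2) ex_has_least_nat[of "\<lambda>z. z \<notin> B'" _ "fst p"] by blast
  obtain z' where z': "z' \<notin> B'" "\<And>y. y \<notin> B' \<Longrightarrow> snd p z' \<le> snd p y"
    using B'(2) ex_has_least_nat[of "\<lambda>z. z \<notin> B'" _ "snd p"] by blast
  have "fst p r < fst p z \<longleftrightarrow> snd p r < snd p z'" for r
  proof (cases "r \<in> B'")
    case True
    then show ?thesis
      using noedge[OF True z(1)] noedge[OF True z'(1)] z(2)[OF z'(1)] z'(2)[OF z(1)] by linarith
  next
    case False
    then show ?thesis using z(2)[of r] z'(2)[of r] by auto
  qed
  moreover have "fst p r \<in> {1..fst p z - 1} \<longleftrightarrow> fst p r < fst p z"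
    "snd p r \<in> {1..snd p z' - 1} \<longleftrightarrow> snd p r < snd p z'" for r
    using fst_perm_bounds(1)[OF perm, of r] snd_perm_bounds(1)[OF perm, of r] by auto
  ultimately have eq: "fst p -` {1..fst p z - 1} = snd p -` {1..snd p z' - 1}"
    by (intro set_eqI) (simp only: vimage_eq)
  have "fst p z \<noteq> fst p a"
    using B'(1) z(1) inj_fst_perm[OF perm] by (metis injD)
  then have "1 \<le> fst p z - 1" "fst p z - 1 < CARD('a)" "snd p z' - 1 \<le> CARD('a)"
    using a fst_perm_bounds[OF perm, of z] snd_perm_bounds[OF perm, of z'] by auto
  then show False by (rule irreducibleD[OF perm irr eq])
qed

section \<open>Transvections and frames\<close>

lemma subspace_H: "subspace (H p)"
  unfolding H_def by (rule linear_subspace_image[OF linear_Omega subspace_UNIV])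

lemma Omega_in_H [simp]: "Omega p u \<in> H p"
  by (simp add: H_def)

text \<open>Independence of the preimage chosen by \<open>inv_into\<close>: two preimages differ by
  an element of the kernel of \<open>Omega p\<close>, which by antisymmetry is orthogonal to
  \<open>H p\<close>.\<close>

lemma sympl_Omega:
  assumes "b \<in> H p"
  shows "sympl p (Omega p a) b = a \<bullet> b"
proof -
  obtain v where v: "b = Omega p v" using assms by (auto simp: H_def)
  have "Omega p (inv_into UNIV (Omega p) (Omega p a)) = Omega p a"
    by (rule f_inv_into_f) simp
  then show ?thesis
    unfolding sympl_def v by (simp add: inner_Omega)
qed

text \<open>Since \<open>sympl\<close> involves a chosen preimage, its bilinearity is not visible.
  On \<open>H p\<close>, however, fixing either argument leaves up to sign the inner product with a
  fixed vector, whose zeros form a subspace.\<close>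

lemma isotropic_span:
  assumes "S \<subseteq> H p" and zero: "\<And>a b. a \<in> S \<Longrightarrow> b \<in> S \<Longrightarrow> sympl p a b = 0"
  shows "isotropic p (span S)"
  unfolding isotropic_def
proof (intro ballI)
  have H: "span S \<subseteq> H p" using assms(1) by (rule span_minimal[OF _ subspace_H])
  have 1: "sympl p a b = 0" if a: "a \<in> S" and b: "b \<in> span S" for a b
  proof -
    obtain c where c: "a = Omega p c" using a assms(1) by (auto simp: H_def)
    have "span S \<subseteq> {b. c \<bullet> b = 0}"
    proof (rule span_minimal)
      show "S \<subseteq> {b. c \<bullet> b = 0}"
        using zero[OF a] assms(1) sympl_Omega[of _ p c] c by fastforce
    qed (rule subspace_hyperplane)
    then have "c \<bullet> b = 0" using b by blast
    then show ?thesis using b H sympl_Omega[of b p c] c by auto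
  qed
  fix a b assume ab: "a \<in> span S" "b \<in> span S"
  obtain d where d: "b = Omega p d" using ab(2) H by (auto simp: H_def)
  have eq: "sympl p x b = - (d \<bullet> x)" if x: "x \<in> H p" for x
  proof -
    obtain c where "x = Omega p c" using x by (auto simp: H_def)
    then show ?thesis
      using sympl_Omega[of b p c] inner_Omega[of c p d] d by (simp add: inner_commute[of d])
  qed
  have "span S \<subseteq> {x. d \<bullet> x = 0}"
  proof (rule span_minimal)
    show "S \<subseteq> {x. d \<bullet> x = 0}"
      using 1[OF _ ab(2)] eq assms(1) by fastforce
  qed (rule subspace_hyperplane)
  then have "d \<bullet> a = 0" "a \<in> H p" using ab(1) H by blast+
  then show "sympl p a b = 0" using eq[of a] by simp
qed

text \<open>On \<open>H p\<close> the coefficient \<open>u \<bullet> x\<close> is the symplectic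
  product of \<open>Omega p u\<close> with \<open>x\<close>, so this is the symplectic transvection
  along \<open>Omega p u\<close> with strength \<open>s\<close>.\<close>

definition transvec :: "'a::finite perm \<Rightarrow> real \<Rightarrow> real^'a \<Rightarrow> real^'a \<Rightarrow> real^'a" where
  "transvec p s u x = x + (s * (u \<bullet> x)) *\<^sub>R Omega p u"

text \<open>The transvection on parameters: \<open>Omega\<close> intertwines \<open>transvec_dual\<close> and \<open>transvec\<close>.\<close>
definition transvec_dual :: "'a::finite perm \<Rightarrow> real \<Rightarrow> real^'a \<Rightarrow> real^'a \<Rightarrow> real^'a" where
  "transvec_dual p s v u = u + (s * (v \<bullet> Omega p u)) *\<^sub>R v"

lemmas Omega_simps = linear_add[OF linear_Omega] linear_diff[OF linear_Omega]
  linear_scale[OF linear_Omega]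

lemma linear_transvec: "linear (transvec p s u)"
  by (rule linearI) (auto simp: transvec_def algebra_simps inner_add_right)

lemma transvec_add: "transvec p s u (transvec p t u x) = transvec p (s + t) u x"
  by (simp add: transvec_def inner_add_right algebra_simps)

lemma transvec_0 [simp]: "transvec p 0 u = id"
  by (simp add: transvec_def fun_eq_iff)

lemma inj_transvec: "inj (transvec p s u)"
  by (rule inj_on_inverseI[of _ "transvec p (- s) u"]) (simp add: transvec_add)

lemma transvec_in_H: "x \<in> H p \<Longrightarrow> transvec p s u x \<in> H p"
  unfolding transvec_def by (intro subspace_add[OF subspace_H] subspace_scale[OF subspace_H]) auto

lemma Omega_transvec_dual: "Omega p (transvec_dual p s v u) = transvec p s v (Omega p u)"
  by (simp add: transvec_dual_def transvec_def Omega_simps)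

lemma inner_transvec_dual: "transvec_dual p s v u \<bullet> transvec p s v x = u \<bullet> x"
  by (simp add: transvec_dual_def transvec_def inner_add_left inner_add_right algebra_simps
      inner_Omega[of u p v] inner_commute[of v "Omega p u"])

lemma transvec_dual_inverse: "transvec_dual p s v (transvec_dual p (- s) v u) = u"
  by (simp add: transvec_dual_def Omega_simps inner_add_right algebra_simps)

lemma transvec_dual_diff:
  "transvec_dual p s v (x - y) = transvec_dual p s v x - transvec_dual p s v y"
  by (simp add: transvec_dual_def Omega_simps inner_diff_right algebra_simps)

text \<open>Conjugating a transvection by a symplectic map moves its direction by that map; on
  parameters the map is \<open>transvec_dual\<close>.\<close>

lemma transvec_conj:
  "transvec p r (transvec_dual p s v u) (transvec p s v x) = transvec p s v (transvec p r u x)"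
  unfolding transvec_def[of p r] inner_transvec_dual Omega_transvec_dual
  by (simp add: linear_add[OF linear_transvec] linear_scale[OF linear_transvec])

lemma sympl_transvec:
  assumes "x \<in> H p" "y \<in> H p"
  shows "sympl p (transvec p s u x) (transvec p s u y) = sympl p x y"
proof -
  obtain a where a: "x = Omega p a" using assms(1) by (auto simp: H_def)
  show ?thesis
    unfolding a Omega_transvec_dual[symmetric]
    by (simp add: sympl_Omega transvec_in_H assms(2) inner_transvec_dual)
qed

section \<open>Frames adapted to Lagrangian flags\<close>

definition frame :: "'a::finite perm \<Rightarrow> (nat \<Rightarrow> real^'a) \<Rightarrow> bool" where
  "frame p f \<longleftrightarrow> (\<forall>i\<in>{1..genus p}. f i \<in> H p \<and> f i \<notin> span (f ` {1..<i}) \<and>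
     (\<forall>j\<in>{1..genus p}. sympl p (f i) (f j) = 0))"

definition flag_of :: "'a::finite perm \<Rightarrow> (nat \<Rightarrow> real^'a) \<Rightarrow> nat \<Rightarrow> (real^'a) set" where
  "flag_of p f = (\<lambda>i. if i \<in> {1..genus p} then span (f ` {1..i}) else {})"

definition flag_map :: "'a::finite perm \<Rightarrow> (real^'a \<Rightarrow> real^'a) \<Rightarrow> (nat \<Rightarrow> (real^'a) set) \<Rightarrow> nat \<Rightarrow> (real^'a) set" where
  "flag_map p T F = (\<lambda>i. if i \<in> {1..genus p} then T ` F i else {})"

lemma span_comp_image: "linear T \<Longrightarrow> span ((T \<circ> f) ` A) = T ` span (f ` A)"
  by (simp only: image_comp[symmetric] linear_span_image)

lemma flag_map_flag_of: "linear T \<Longrightarrow> flag_map p T (flag_of p f) = flag_of p (T \<circ> f)"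
  by (simp add: flag_map_def flag_of_def fun_eq_iff span_comp_image del: comp_apply)

lemma insert_image_atLeastAtMost: "f ` {1..Suc i} = insert (f (Suc i)) (f ` {1..i})"
  by (simp add: atLeastAtMostSuc_conv)

lemma frame_notin_span:
  assumes "frame p f" "i < genus p"
  shows "f (Suc i) \<notin> span (f ` {1..i})"
  using assms(1)[unfolded frame_def, rule_format, of "Suc i"] assms(2)
  by (simp add: atLeastLessThanSuc_atLeastAtMost)

lemma dim_span_frame:
  assumes "frame p f" "i \<le> genus p"
  shows "dim (span (f ` {1..i})) = i"
  using assms(2)
proof (induction i)
  case (Suc i)
  have "f (Suc i) \<notin> span (f ` {1..i})"
    using Suc.prems by (intro frame_notin_span[OF assms(1)]) simp
  then show ?case using Suc by (simp add: dim_insert insert_image_atLeastAtMost del: One_nat_def)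
qed simp

lemma flag_of_in_lagr_flags:
  assumes f: "frame p f"
  shows "flag_of p f \<in> lagr_flags p"
proof -
  have H: "f ` {1..i} \<subseteq> H p" if "i \<le> genus p" for i
    using f that by (auto simp: frame_def)
  moreover have "isotropic p (span (f ` {1..i}))" if "i \<le> genus p" for i
    using f that by (intro isotropic_span H) (auto simp: frame_def)
  moreover have "span (f ` {1..i}) \<subseteq> H p" if "i \<le> genus p" for i
    using H[OF that] by (rule span_minimal[OF _ subspace_H])
  moreover have "span (f ` {1..i}) \<subseteq> span (f ` {1..Suc i})" for i
    by (intro span_mono image_mono) auto
  ultimately show ?thesis
    using dim_span_frame[OF f] by (simp add: lagr_flags_def flag_of_def)
qed

lemma ex_frame:
  assumes F: "F \<in> lagr_flags p"
  obtains f where "frame p f" "flag_of p f = F"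
proof -
  \<comment> \<open>Flags have the value \<open>{}\<close> at 0; the zero space put there starts the
    inductions uniformly.\<close>
  define E where "E i = (if i = 0 then {0} else F i)" for i
  have E: "subspace (E i)" "E i \<subseteq> H p" "dim (E i) = i" if "i \<le> genus p" for i
    using that F subspace_0[OF subspace_H, of p] by (auto simp: E_def lagr_flags_def)
  have iso: "isotropic p (E i)" if "i \<in> {1..genus p}" for i
    using that F by (auto simp: E_def lagr_flags_def)
  have E_Suc: "E i \<subseteq> E (Suc i)" if "i < genus p" for i
    using that F subspace_0[OF E(1), of "Suc 0"] by (auto simp: E_def lagr_flags_def)
  have "\<exists>x\<in>E (Suc i). x \<notin> E i" if "i < genus p" for i
    using dim_subset[of "E (Suc i)" "E i"] E(3)[of i] E(3)[of "Suc i"] that by auto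
  then obtain g where g: "\<And>i. i < genus p \<Longrightarrow> g i \<in> E (Suc i) \<and> g i \<notin> E i"
    by metis
  define f where "f i = g (i - 1)" for i
  have span: "span (f ` {1..i}) = E i" if "i \<le> genus p" for i
    using that
  proof (induction i)
    case 0
    show ?case by (simp add: E_def)
  next
    case (Suc i)
    then have IH: "span (f ` {1..i}) = E i" by simp
    have fi: "f (Suc i) \<in> E (Suc i)" "f (Suc i) \<notin> E i"
      using g[of i] Suc.prems by (auto simp: f_def)
    have "f ` {1..i} \<subseteq> E i" using span_superset[of "f ` {1..i}"] by (simp only: IH)
    then have "span (f ` {1..Suc i}) \<subseteq> E (Suc i)"
      using fi(1) E_Suc[of i] Suc.prems E(1)[OF Suc.prems]
      unfolding insert_image_atLeastAtMost by (intro span_minimal) auto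
    moreover have "dim (span (f ` {1..Suc i})) = Suc i"
      unfolding insert_image_atLeastAtMost dim_span dim_insert
      using fi IH E(3)[of i] Suc.prems dim_span[of "f ` {1..i}"] by (simp del: dim_span One_nat_def)
    ultimately show ?case
      using subspace_dim_equal[OF subspace_span E(1)[OF Suc.prems]] E(3)[OF Suc.prems] by simp
  qed
  have in_E: "f i \<in> E (genus p)" if "i \<in> {1..genus p}" for i
    unfolding span[OF order_refl, symmetric] using that by (intro span_base imageI)
  have "f i \<notin> span (f ` {1..<i})" if i: "i \<in> {1..genus p}" for i
  proof -
    obtain j where j: "i = Suc j" using i by (cases i) auto
    then have "span (f ` {1..<i}) = E j" "f i = g j" "j < genus p"
      using i span[of j] by (auto simp: f_def atLeastLessThanSuc_atLeastAtMost)
    then show ?thesis using g[of j] by simp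
  qed
  moreover have "f i \<in> H p" if "i \<in> {1..genus p}" for i
    using in_E[OF that] E(2)[OF order_refl] by blast
  moreover have "sympl p (f i) (f j) = 0" if "i \<in> {1..genus p}" "j \<in> {1..genus p}" for i j
  proof -
    have "isotropic p (E (genus p))" using that by (intro iso) simp
    then show ?thesis using that in_E by (simp only: isotropic_def)
  qed
  ultimately have "frame p f" by (simp only: frame_def) blast
  moreover have "flag_of p f i = F i" for i
  proof (cases "i \<in> {1..genus p}")
    case True
    then show ?thesis using span[of i] by (simp add: flag_of_def E_def)
  next
    case False
    then show ?thesis using F unfolding flag_of_def lagr_flags_def by auto
  qed
  ultimately show ?thesis by (intro that[of f]) auto
qed

lemma frame_transvec:
  assumes "frame p f"
  shows "frame p (transvec p s u \<circ> f)"
  using assms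
  by (simp add: frame_def transvec_in_H sympl_transvec inj_image_mem_iff[OF inj_transvec]
      span_comp_image[OF linear_transvec, unfolded comp_def])

text \<open>A triangular change of basis preserves the spans of initial segments. This freedom is
  used to renormalise frames that diverge under the powers of a transvection.\<close>

lemma span_triangular:
  assumes "1 \<le> m" "c \<noteq> 0"
  shows "span ((\<lambda>i. if i = 1 then c *\<^sub>R f 1 else f i - d i *\<^sub>R f 1) ` {1..m::nat}) =
    span (f ` {1..m})" (is "span (?g ` _) = _")
proof (rule subset_antisym; rule span_minimal; (rule subspace_span)?)
  have f: "f i \<in> span (f ` {1..m})" if "i \<in> {1..m}" for i
    using that by (auto intro: span_base)
  then show "?g ` {1..m} \<subseteq> span (f ` {1..m})"
    using assms(1) by (auto intro!: span_diff span_scale)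
  have g: "?g i \<in> span (?g ` {1..m})" if "i \<in> {1..m}" for i
    using that by (auto intro: span_base)
  have "(1 / c) *\<^sub>R ?g 1 \<in> span (?g ` {1..m})"
    using assms(1) by (intro span_scale g) simp
  moreover have "(1 / c) *\<^sub>R ?g 1 = f 1" using assms(2) by simp
  ultimately have f1: "f 1 \<in> span (?g ` {1..m})" by (simp only:)
  show "f ` {1..m} \<subseteq> span (?g ` {1..m})"
  proof
    fix x assume "x \<in> f ` {1..m}"
    then obtain i where i: "i \<in> {1..m}" "x = f i" by auto
    show "x \<in> span (?g ` {1..m})"
    proof (cases "i = 1")
      case False
      then have "x = ?g i + d i *\<^sub>R f 1" using i by simp
      moreover have "?g i + d i *\<^sub>R f 1 \<in> span (?g ` {1..m})"
        by (intro span_add span_scale f1 g i(1))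
      ultimately show ?thesis by (simp only:)
    qed (use f1 i in simp)
  qed
qed

lemma flag_of_triangular:
  assumes "c \<noteq> 0"
  shows "flag_of p (\<lambda>i. if i = 1 then c *\<^sub>R f 1 else f i - d i *\<^sub>R f 1) = flag_of p f"
  using span_triangular[OF _ assms, of _ f d] by (auto simp: flag_of_def fun_eq_iff)

lemma frame_triangular:
  assumes f: "frame p f" and c: "c \<noteq> 0"
  shows "frame p (\<lambda>i. if i = 1 then c *\<^sub>R f 1 else f i - d i *\<^sub>R f 1)" (is "frame p ?g")
proof -
  let ?V = "span (f ` {1..genus p})"
  have lagr: "?V \<subseteq> H p \<and> isotropic p ?V" if "1 \<le> genus p"
    using flag_of_in_lagr_flags[OF f] that by (auto simp: lagr_flags_def flag_of_def)
  have V: "?g i \<in> ?V" if "i \<in> {1..genus p}" for i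
    using that by (auto intro!: span_diff span_scale intro: span_base)
  have "?g i \<notin> span (?g ` {1..<i})" if i: "i \<in> {1..genus p}" for i
  proof (cases "i = 1")
    case True
    then show ?thesis using frame_notin_span[OF f, of 0] i c by simp
  next
    case False
    obtain j where j: "i = Suc j" "1 \<le> j" using i False by (cases i) auto
    have "f i \<notin> span (f ` {1..j})"
      using i j frame_notin_span[OF f, of j] by simp
    moreover have "d i *\<^sub>R f 1 \<in> span (f ` {1..j})"
      using j by (auto intro!: span_scale intro: span_base)
    ultimately have "f i - d i *\<^sub>R f 1 \<notin> span (f ` {1..j})"
      by (metis diff_add_cancel span_add)
    then show ?thesis
      using False span_triangular[OF j(2) c, of f d] j(1)
      by (simp add: atLeastLessThanSuc_atLeastAtMost del: One_nat_def)
  qed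
  moreover have "?g i \<in> H p" if "i \<in> {1..genus p}" for i
    using V[OF that] lagr that by auto
  moreover have "sympl p (?g i) (?g j) = 0" if "i \<in> {1..genus p}" "j \<in> {1..genus p}" for i j
    using V[OF that(1)] V[OF that(2)] lagr that(1) unfolding isotropic_def by auto
  ultimately show ?thesis by (simp only: frame_def) blast
qed

section \<open>The topology of the flag space\<close>

lemma orth_proj_eqI:
  assumes "subspace V" "q \<in> V" "\<And>v. v \<in> V \<Longrightarrow> (x - q) \<bullet> v = 0"
  shows "orth_proj V x = q"
  unfolding orth_proj_def
proof (rule the_equality)
  fix q' assume q': "q' \<in> V \<and> (\<forall>v\<in>V. (x - q') \<bullet> v = 0)"
  have "q - q' \<in> V" using assms(1,2) q' by (simp add: subspace_diff)
  then have "(q - q') \<bullet> (q - q') = (x - q') \<bullet> (q - q') - (x - q) \<bullet> (q - q')"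
    by (simp add: inner_diff_left)
  also have "\<dots> = 0" using assms(3) q' \<open>q - q' \<in> V\<close> by simp
  finally show "q' = q" by simp
qed (use assms in auto)

lemma
  assumes "subspace V"
  shows orth_proj_in: "orth_proj V x \<in> V"
    and orth_proj_orth: "v \<in> V \<Longrightarrow> (x - orth_proj V x) \<bullet> v = 0"
proof -
  obtain y z where yz: "y \<in> span V" "\<And>w. w \<in> span V \<Longrightarrow> orthogonal z w" "x = y + z"
    using orthogonal_subspace_decomp_exists by metis
  have V: "span V = V" using assms by (rule span_eq_iff[THEN iffD2])
  then have "orth_proj V x = y"
    using yz[unfolded V] by (intro orth_proj_eqI assms) (auto simp: orthogonal_def)
  then show "orth_proj V x \<in> V" "v \<in> V \<Longrightarrow> (x - orth_proj V x) \<bullet> v = 0"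
    using yz[unfolded V] by (auto simp: orthogonal_def)
qed

lemma linear_orth_proj: "subspace V \<Longrightarrow> linear (orth_proj V)"
  by (rule linearI; rule orth_proj_eqI)
    (auto simp: orth_proj_in subspace_add subspace_scale add_diff_add inner_add_left orth_proj_orth
      simp flip: scaleR_diff_right)

text \<open>One Gram-Schmidt step, with \<open>r\<close> the part of \<open>x\<close> orthogonal to
  \<open>span S\<close>. If \<open>x\<close> already lies in that span, then \<open>r = 0\<close>
  and the last summand vanishes.\<close>

lemma orth_proj_span_insert:
  fixes x y :: "real^'a" and S
  defines "r \<equiv> x - orth_proj (span S) x"
  shows "orth_proj (span (insert x S)) y =
    orth_proj (span S) y + ((r \<bullet> y) / (r \<bullet> r)) *\<^sub>R r"
proof (rule orth_proj_eqI)
  let ?P = "orth_proj (span S)" and ?c = "(r \<bullet> y) / (r \<bullet> r)"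
  have S: "span S \<subseteq> span (insert x S)" by (rule span_mono) auto
  have P: "?P z \<in> span (insert x S)" for z
    using S orth_proj_in[OF subspace_span, of S z] by blast
  have "r \<in> span (insert x S)"
    unfolding r_def by (rule span_diff[OF span_base[OF insertI1] P])
  then show "?P y + ?c *\<^sub>R r \<in> span (insert x S)"
    by (intro span_add span_scale P)
  have rv: "r \<bullet> v = 0" if "v \<in> span S" for v
    unfolding r_def by (rule orth_proj_orth[OF subspace_span that])
  have Pv: "(y - ?P y) \<bullet> v = 0" if "v \<in> span S" for v
    by (rule orth_proj_orth[OF subspace_span that])
  have 1: "(y - (?P y + ?c *\<^sub>R r)) \<bullet> v = 0" if "v \<in> span S" for v
    using rv[OF that] Pv[OF that] by (simp add: inner_diff_left inner_add_left)
  have "r \<bullet> ?P y = 0" by (rule rv[OF orth_proj_in[OF subspace_span]])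
  then have "r \<bullet> (y - (?P y + ?c *\<^sub>R r)) = 0"
    by (simp add: inner_diff_right inner_add_right)
  then have 2: "(y - (?P y + ?c *\<^sub>R r)) \<bullet> r = 0" by (subst inner_commute)
  fix v assume "v \<in> span (insert x S)"
  then obtain k where k: "v - k *\<^sub>R x \<in> span S"
    using span_breakdown_eq by blast
  define w where "w = v - k *\<^sub>R x + k *\<^sub>R ?P x"
  have "w \<in> span S"
    unfolding w_def by (intro span_add span_scale k orth_proj_in subspace_span)
  moreover have "v = w + k *\<^sub>R r"
    by (simp add: w_def r_def algebra_simps)
  ultimately show "(y - (?P y + ?c *\<^sub>R r)) \<bullet> v = 0"
    using 1[of w] 2 by (simp only: inner_add_right inner_scaleR_right mult_zero_right add_0)
qed simp

text \<open>Induction by Gram-Schmidt steps. Independence is needed only in the limit, where it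
  keeps the denominators away from 0. The projected point varies with \<open>k\<close> because the
  induction also projects the next frame vector.\<close>

lemma tendsto_orth_proj:
  fixes f :: "nat \<Rightarrow> nat \<Rightarrow> real^'a"
  assumes "\<And>i. i \<in> {1..m} \<Longrightarrow> (\<lambda>k. f k i) \<longlonglongrightarrow> g i"
    and "\<And>i. i \<in> {1..m} \<Longrightarrow> g i \<notin> span (g ` {1..<i})"
    and "y \<longlonglongrightarrow> z"
  shows "(\<lambda>k. orth_proj (span (f k ` {1..m})) (y k)) \<longlonglongrightarrow> orth_proj (span (g ` {1..m})) z"
  using assms
proof (induction m arbitrary: y z)
  case 0
  have "orth_proj {0} x = (0 :: real^'a)" for x
    by (rule orth_proj_eqI) auto
  then show ?case by simp
next
  case (Suc m)
  let ?P = "\<lambda>k. orth_proj (span (f k ` {1..m}))" and ?Q = "orth_proj (span (g ` {1..m}))"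
  have P: "(\<lambda>k. ?P k (y k)) \<longlonglongrightarrow> ?Q z" if "y \<longlonglongrightarrow> z" for y z
  proof (rule Suc.IH[OF _ _ that])
    show "(\<lambda>k. f k i) \<longlonglongrightarrow> g i" if "i \<in> {1..m}" for i
      by (rule Suc.prems(1)) (use that in simp)
    show "g i \<notin> span (g ` {1..<i})" if "i \<in> {1..m}" for i
      by (rule Suc.prems(2)) (use that in simp)
  qed
  have f: "(\<lambda>k. f k (Suc m)) \<longlonglongrightarrow> g (Suc m)" using Suc.prems(1) by simp
  have r: "(\<lambda>k. f k (Suc m) - ?P k (f k (Suc m))) \<longlonglongrightarrow> g (Suc m) - ?Q (g (Suc m))"
    by (intro tendsto_diff f P)
  have "g (Suc m) \<notin> span (g ` {1..m})"
    using Suc.prems(2)[of "Suc m"] by (simp add: atLeastLessThanSuc_atLeastAtMost)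
  moreover have "?Q (g (Suc m)) \<in> span (g ` {1..m})"
    by (rule orth_proj_in[OF subspace_span])
  ultimately have "g (Suc m) - ?Q (g (Suc m)) \<noteq> 0" by auto
  then have "(g (Suc m) - ?Q (g (Suc m))) \<bullet> (g (Suc m) - ?Q (g (Suc m))) \<noteq> 0" by simp
  then show ?case
    unfolding insert_image_atLeastAtMost orth_proj_span_insert
    by (rule tendsto_add[OF P[OF Suc.prems(3)] tendsto_scaleR[OF
            tendsto_divide[OF tendsto_inner[OF r Suc.prems(3)] tendsto_inner[OF r r]] r]])
qed

text \<open>A subspace is recovered from its orthogonal projection as the set of fixed
  points.\<close>

lemma proj_mat_eq_iff:
  assumes "subspace V" "subspace W"
  shows "proj_mat V = proj_mat W \<longleftrightarrow> V = W"
proof -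
  have "V = {x. proj_mat V *v x = x}" if "subspace V" for V :: "(real^'a) set"
  proof -
    have "orth_proj V x = x \<longleftrightarrow> x \<in> V" for x
      using orth_proj_in[OF that, of x] orth_proj_eqI[OF that, of x x] by auto
    then show ?thesis
      using matrix_works[OF linear_orth_proj[OF that, folded linear_matrix_vector_mul_eq]]
      by (simp add: proj_mat_def)
  qed
  note inverse = this
  show ?thesis
  proof
    assume eq: "proj_mat V = proj_mat W"
    show "V = W"
      using inverse[OF assms(1)] unfolding eq inverse[OF assms(2), symmetric] .
  qed simp
qed

text \<open>The form in which closedness of \<open>C\<close> is used throughout: convergent frames
  give convergent projections, and these determine the limit flag. Finitely many terms of the
  sequence may be bad.\<close>

lemma closed_flag_set_limit:
  assumes C: "C \<subseteq> lagr_flags p" "closed_flag_set p C"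
    and ev: "\<forall>\<^sub>F k in sequentially. frame p (f k) \<and> flag_of p (f k) \<in> C"
    and g: "frame p g" and lim: "\<And>i. i \<in> {1..genus p} \<Longrightarrow> (\<lambda>k. f k i) \<longlonglongrightarrow> g i"
  shows "flag_of p g \<in> C"
proof -
  obtain T where T: "closed T" "flag_emb p ` C = flag_emb p ` lagr_flags p \<inter> T"
    using C(2) unfolding closed_flag_set_def closedin_closed by blast
  have "(\<lambda>k. proj_mat (span (f k ` {1..i}))) \<longlonglongrightarrow> proj_mat (span (g ` {1..i}))"
    if "i \<in> {1..genus p}" for i
  proof -
    have "(\<lambda>k. orth_proj (span (f k ` {1..i})) y) \<longlonglongrightarrow> orth_proj (span (g ` {1..i})) y" for y
    proof (rule tendsto_orth_proj)
      show "(\<lambda>k. f k j) \<longlonglongrightarrow> g j" if "j \<in> {1..i}" for j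
        using that \<open>i \<in> {1..genus p}\<close> by (intro lim) simp
      show "g j \<notin> span (g ` {1..<j})" if "j \<in> {1..i}" for j
        using that \<open>i \<in> {1..genus p}\<close> g by (simp add: frame_def)
    qed simp
    then show ?thesis
      unfolding proj_mat_def matrix_def by (intro vec_tendstoI) (simp add: tendsto_vec_nth)
  qed
  then have "(\<lambda>k. flag_emb p (flag_of p (f k)) i) \<longlonglongrightarrow> flag_emb p (flag_of p g) i" for i
    unfolding flag_emb_def flag_of_def
    by (cases "i \<in> {1..genus p}") (simp_all only: if_True if_False tendsto_const)
  then have "limitin (product_topology (\<lambda>i. euclidean) UNIV)
      (\<lambda>k. flag_emb p (flag_of p (f k))) (flag_emb p (flag_of p g)) sequentially"
    unfolding limitin_componentwise by simp
  then have "(\<lambda>k. flag_emb p (flag_of p (f k))) \<longlonglongrightarrow> flag_emb p (flag_of p g)"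
    by (simp only: euclidean_product_topology limitin_canonical_iff)
  moreover have "\<forall>\<^sub>F k in sequentially. flag_emb p (flag_of p (f k)) \<in> T"
    using ev by eventually_elim (use T(2) in blast)
  ultimately have "flag_emb p (flag_of p g) \<in> T"
    by (intro Lim_in_closed_set[OF T(1) _ trivial_limit_sequentially])
  then have "flag_emb p (flag_of p g) \<in> flag_emb p ` C"
    using T(2) flag_of_in_lagr_flags[OF g] by blast
  then obtain F where F: "F \<in> C" "flag_emb p (flag_of p g) = flag_emb p F" by blast
  have "flag_of p g i = F i" for i
  proof (cases "i \<in> {1..genus p}")
    case True
    then have "proj_mat (flag_of p g i) = proj_mat (F i)"
      using fun_cong[OF F(2), of i] by (simp add: flag_emb_def)
    moreover have "subspace (E i)" if "E \<in> lagr_flags p" for E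
      using that True by (simp add: lagr_flags_def)
    ultimately show ?thesis
      using proj_mat_eq_iff flag_of_in_lagr_flags[OF g] subsetD[OF C(1) F(1)] by metis
  next
    case False
    then have "E i = {}" if "E \<in> lagr_flags p" for E
      using that unfolding lagr_flags_def by blast
    then show ?thesis
      using flag_of_in_lagr_flags[OF g] subsetD[OF C(1) F(1)] by metis
  qed
  then have "flag_of p g = F" by (rule ext)
  then show ?thesis using F(1) by simp
qed

section \<open>From integral to real transvections\<close>

text \<open>The subtractive Euclidean algorithm read backwards. Depending on the signs, adding or
  subtracting the entry of smaller modulus makes the sum of the moduli decrease and preserves
  coprimality.\<close>

lemma coprime_pairs_induct:
  fixes P :: "int \<Rightarrow> int \<Rightarrow> bool"
  assumes step: "\<And>m n. P m n \<Longrightarrow> P (m + n) n" "\<And>m n. P m n \<Longrightarrow> P (m - n) n"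
    "\<And>m n. P m n \<Longrightarrow> P m (n + m)" "\<And>m n. P m n \<Longrightarrow> P m (n - m)"
    and "P 1 0" and "coprime m n"
  shows "P m n"
  using \<open>coprime m n\<close>
proof (induction "nat (\<bar>m\<bar> + \<bar>n\<bar>)" arbitrary: m n rule: less_induct)
  case less
  \<comment> \<open>The elementary moves lead from \<open>(1, 0)\<close> round all four coprime
    pairs with a zero entry, where the descent ends.\<close>
  have units: "P 1 0" "P 0 1" "P (- 1) 0" "P 0 (- 1)"
  proof -
    show "P 1 0" by fact
    from step(3)[OF this] have "P 1 1" by simp
    from step(2)[OF this] show "P 0 1" by simp
    from step(2)[OF this] have "P (- 1) 1" by simp
    from step(3)[OF this] show "P (- 1) 0" by simp
    from step(3)[OF this] have "P (- 1) (- 1)" by simp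
    from step(2)[OF this] show "P 0 (- 1)" by simp
  qed
  have IH: "P a b" if "\<bar>a\<bar> + \<bar>b\<bar> < \<bar>m\<bar> + \<bar>n\<bar>" "coprime a b" for a b
    using that by (intro less.hyps) auto
  have cop: "coprime (m - n) n" "coprime (m + n) n" "coprime m (n - m)" "coprime m (n + m)"
    using less.prems by (simp_all add: coprime_iff_gcd_eq_1 gcd_diff1 gcd.commute[of m]
        gcd.commute[of _ "n - m"] gcd.commute[of _ "n + m"])
  consider "m = 0" | "n = 0" | "m \<noteq> 0" "n \<noteq> 0" "\<bar>n\<bar> \<le> \<bar>m\<bar>" "m * n > 0"
    | "m \<noteq> 0" "n \<noteq> 0" "\<bar>n\<bar> \<le> \<bar>m\<bar>" "m * n < 0"
    | "m \<noteq> 0" "n \<noteq> 0" "\<bar>m\<bar> \<le> \<bar>n\<bar>" "m * n > 0"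
    | "m \<noteq> 0" "n \<noteq> 0" "\<bar>m\<bar> \<le> \<bar>n\<bar>" "m * n < 0"
    using mult_eq_0_iff[of m n] by linarith
  then show ?case
  proof cases
    case 1
    then have "n = 1 \<or> n = - 1" using less.prems by auto
    then show ?thesis using units 1 by auto
  next
    case 2
    then have "m = 1 \<or> m = - 1" using less.prems by auto
    then show ?thesis using units 2 by auto
  next
    case 3
    then have "P (m - n) n" by (intro IH cop) (auto simp: zero_less_mult_iff)
    from step(1)[OF this] show ?thesis by simp
  next
    case 4
    then have "P (m + n) n" by (intro IH cop) (auto simp: mult_less_0_iff)
    from step(2)[OF this] show ?thesis by simp
  next
    case 5
    then have "P m (n - m)" by (intro IH cop) (auto simp: zero_less_mult_iff)
    from step(3)[OF this] show ?thesis by simp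
  next
    case 6
    then have "P m (n + m)" by (intro IH cop) (auto simp: mult_less_0_iff)
    from step(4)[OF this] show ?thesis by simp
  qed
qed

text \<open>The images of the line \<open>b = s\<close> under \<open>SL\<^sub>2(\<int>)\<close> are the lines \<open>m b - n a = s\<close> with \<open>m\<close> and \<open>n\<close>
  coprime. Those with \<open>n\<close> a power of two and \<open>m\<close> odd already have a dense union.\<close>
lemma plane_density:
  fixes Q :: "(real \<times> real) set"
  assumes closed: "closed Q"
    and inv: "\<And>a b. (a, b) \<in> Q \<Longrightarrow> (a + b, b) \<in> Q" "\<And>a b. (a, b) \<in> Q \<Longrightarrow> (a - b, b) \<in> Q"
      "\<And>a b. (a, b) \<in> Q \<Longrightarrow> (a, b + a) \<in> Q" "\<And>a b. (a, b) \<in> Q \<Longrightarrow> (a, b - a) \<in> Q"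
    and line: "\<And>a. (a, s) \<in> Q"
  shows "Q = UNIV"
proof -
  define P where "P m n \<longleftrightarrow> (\<forall>a b. of_int m * b - of_int n * a = s \<longrightarrow> (a, b) \<in> Q)" for m n :: int
  have P: "P m n" if "coprime m n" for m n
    using that
  proof (rule coprime_pairs_induct[rotated 5])
    fix m n assume mn: "P m n"
    show "P (m + n) n"
      unfolding P_def
    proof (intro allI impI)
      fix a b assume "of_int (m + n) * b - of_int n * a = s"
      then have "(a - b, b) \<in> Q" using mn unfolding P_def by (simp add: algebra_simps)
      from inv(1)[OF this] show "(a, b) \<in> Q" by simp
    qed
    show "P (m - n) n"
      unfolding P_def
    proof (intro allI impI)
      fix a b assume "of_int (m - n) * b - of_int n * a = s"
      then have "(a + b, b) \<in> Q" using mn unfolding P_def by (simp add: algebra_simps)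
      from inv(2)[OF this] show "(a, b) \<in> Q" by simp
    qed
    show "P m (n + m)"
      unfolding P_def
    proof (intro allI impI)
      fix a b assume "of_int m * b - of_int (n + m) * a = s"
      then have "(a, b - a) \<in> Q" using mn unfolding P_def by (simp add: algebra_simps)
      from inv(3)[OF this] show "(a, b) \<in> Q" by simp
    qed
    show "P m (n - m)"
      unfolding P_def
    proof (intro allI impI)
      fix a b assume "of_int m * b - of_int (n - m) * a = s"
      then have "(a, b + a) \<in> Q" using mn unfolding P_def by (simp add: algebra_simps)
      from inv(4)[OF this] show "(a, b) \<in> Q" by simp
    qed
  next
    show "P 1 0" using line by (simp add: P_def)
  qed
  have ne0: "(a, b) \<in> Q" if b: "b \<noteq> 0" for a b
  proof -
    \<comment> \<open>\<open>m k\<close> is an odd integer at distance at most 1 from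
      \<open>(2 ^ k * a + s) / b\<close>, and \<open>(x k, b)\<close> is the point at height
      \<open>b\<close> on the line belonging to \<open>m k\<close> and \<open>2 ^ k\<close>. Hence
      \<open>x k\<close> is within \<open>\<bar>b\<bar> / 2 ^ k\<close> of \<open>a\<close>.\<close>
    define m where "m k = 2 * \<lfloor>(2 ^ k * a + s) / b / 2\<rfloor> + 1" for k :: nat
    define x where "x k = (of_int (m k) * b - s) / 2 ^ k" for k
    have "(x k, b) \<in> Q" for k
    proof -
      have "coprime (m k) (2 ^ k)" by (simp add: m_def)
      from P[OF this] have "of_int (m k) * b - 2 ^ k * x k = s \<longrightarrow> (x k, b) \<in> Q"
        unfolding P_def by simp
      then show ?thesis by (simp add: x_def)
    qed
    moreover have "x \<longlonglongrightarrow> a"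
    proof (rule LIMSEQ_I)
      have bound: "\<bar>x k - a\<bar> \<le> \<bar>b\<bar> * (1 / 2) ^ k" for k
      proof -
        have "\<bar>of_int (2 * \<lfloor>y / 2\<rfloor> + 1) - y\<bar> \<le> 1" for y :: real
          using floor_correct[of "y / 2"] by (intro abs_leI; simp; linarith)
        then have "\<bar>of_int (m k) - (2 ^ k * a + s) / b\<bar> \<le> 1" unfolding m_def .
        then have "\<bar>b\<bar> * \<bar>of_int (m k) - (2 ^ k * a + s) / b\<bar> / 2 ^ k \<le> \<bar>b\<bar> * 1 / 2 ^ k"
          by (intro divide_right_mono mult_left_mono) auto
        moreover have "x k - a = b * (of_int (m k) - (2 ^ k * a + s) / b) / 2 ^ k"
          using b by (simp add: x_def field_simps)
        ultimately show ?thesis by (simp only: abs_mult abs_divide) (simp add: power_one_over)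
      qed
      have "(\<lambda>k. \<bar>b\<bar> * (1 / 2) ^ k) \<longlonglongrightarrow> \<bar>b\<bar> * 0"
        by (intro tendsto_intros LIMSEQ_realpow_zero) auto
      fix r :: real assume "r > 0"
      then obtain N where "\<And>k. k \<ge> N \<Longrightarrow> \<bar>b\<bar> * (1 / 2) ^ k < r"
        using LIMSEQ_D[OF \<open>(\<lambda>k. \<bar>b\<bar> * (1 / 2) ^ k) \<longlonglongrightarrow> \<bar>b\<bar> * 0\<close>, of r] by auto
      then show "\<exists>N. \<forall>k\<ge>N. norm (x k - a) < r"
        using bound by (intro exI[of _ N]) (auto intro: le_less_trans)
    qed
    then have "(\<lambda>k. (x k, b)) \<longlonglongrightarrow> (a, b)" by (intro tendsto_Pair tendsto_const)
    ultimately show ?thesis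
      using closed_sequentially[OF closed, of "\<lambda>k. (x k, b)" "(a, b)"] by blast
  qed
  \<comment> \<open>The lines above cannot be used at height 0, which is reached as a limit of
    positive heights.\<close>
  have "(a, 0) \<in> Q" for a
  proof -
    have "(\<lambda>k. (a, inverse (real (Suc k)))) \<longlonglongrightarrow> (a, 0)"
      by (intro tendsto_Pair tendsto_const LIMSEQ_inverse_real_of_nat)
    moreover have "(a, inverse (real (Suc k))) \<in> Q" for k by (rule ne0) simp
    ultimately show ?thesis
      using closed_sequentially[OF closed, of "\<lambda>k. (a, inverse (real (Suc k)))" "(a, 0)"] by blast
  qed
  then show ?thesis using ne0 by (metis UNIV_eq_I surj_pair)
qed

text \<open>A largest nonempty \<open>B\<close> with \<open>S B \<subseteq> D\<close> consists of
  all letters. Otherwise an edge from \<open>w\<close> to \<open>z\<close> leaves \<open>B\<close>,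
  and the transvections at its ends act on the plane of the two axes as elementary matrices of
  \<open>SL\<^sub>2(\<int>)\<close>; density in that plane enlarges \<open>B\<close> by
  \<open>z\<close>.\<close>

lemma transvec_dual_closed_eq_UNIV:
  fixes p :: "'a::finite perm" and D :: "(real^'a) set"
  assumes irr: "irreducible_perm p" and closed: "closed D"
    and inv: "\<And>u w s. u \<in> D \<Longrightarrow> s \<in> {1, -1} \<Longrightarrow> transvec_dual p s (axis w 1) u \<in> D"
    and axis: "\<And>c w. c *\<^sub>R axis w 1 \<in> D"
  shows "D = UNIV"
proof -
  define S where "S B = {u :: real^'a. \<forall>x. x \<notin> B \<longrightarrow> u $ x = 0}" for B
  have extend: "S (insert z B) \<subseteq> D"
    if B: "S B \<subseteq> D" and w: "w \<in> B" and z: "z \<notin> B" and wz: "omega_entry p w z \<noteq> 0" for B w z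
  proof
    fix u assume u: "u \<in> S (insert z B)"
    let ?w = "axis w 1 :: real^'a" and ?z = "axis z 1 :: real^'a"
    define e where "e = omega_entry p z w"
    have e: "e = 1 \<or> e = - 1"
      using wz omega_entry_antisym[of p w z] by (auto simp: e_def omega_entry_def split: if_splits)
    have pair: "?w \<bullet> Omega p ?z = e" "?z \<bullet> Omega p ?w = - e"
      "?w \<bullet> Omega p ?w = 0" "?z \<bullet> Omega p ?z = 0"
      using omega_entry_antisym[of p w z] by (simp_all add: inner_axis' Omega_axis e_def)
    \<comment> \<open>These coefficients make the remainder \<open>r\<close> pair to zero with both
      axes, so that the two transvections fix \<open>r\<close> and move only the plane part.\<close>
    define a where "a = - e * (?z \<bullet> Omega p u)"
    define b where "b = e * (?w \<bullet> Omega p u)"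
    define r where "r = u - a *\<^sub>R ?w - b *\<^sub>R ?z"
    have r: "?w \<bullet> Omega p r = 0" "?z \<bullet> Omega p r = 0"
      using e pair by (auto simp: r_def a_def b_def Omega_simps inner_diff_right inner_add_right)
    define Q where "Q = {q. r + fst q *\<^sub>R ?w + snd q *\<^sub>R ?z \<in> D}"
    have dual_w: "transvec_dual p s ?w (r + a *\<^sub>R ?w + b *\<^sub>R ?z) = r + (a + s * e * b) *\<^sub>R ?w + b *\<^sub>R ?z"
      and dual_z: "transvec_dual p s ?z (r + a *\<^sub>R ?w + b *\<^sub>R ?z) = r + a *\<^sub>R ?w + (b - s * e * a) *\<^sub>R ?z"
      for s a b
      using r pair by (simp_all add: transvec_dual_def Omega_simps inner_add_right algebra_simps)
    have inv_w: "(a + s * b, b) \<in> Q" and inv_z: "(a, b - s * a) \<in> Q"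
      if "(a, b) \<in> Q" "s \<in> {1, -1}" for a b s
    proof -
      have D: "r + a *\<^sub>R ?w + b *\<^sub>R ?z \<in> D" using that by (simp add: Q_def)
      have se: "s * e \<in> {1, -1}" "s * e * e = s" using that(2) e by auto
      show "(a + s * b, b) \<in> Q" using inv[OF D se(1), of w] by (simp add: dual_w se(2) Q_def)
      show "(a, b - s * a) \<in> Q" using inv[OF D se(1), of z] by (simp add: dual_z se(2) Q_def)
    qed
    have "Q = UNIV"
    proof (rule plane_density)
      have cont: "continuous_on UNIV (\<lambda>q::real \<times> real. r + fst q *\<^sub>R ?w + snd q *\<^sub>R ?z)"
        by (intro continuous_intros)
      show "closed Q"
        using closed_vimage[OF closed cont] by (simp add: vimage_def Q_def)
      \<comment> \<open>The starting line: the height \<open>- r $ z\<close> cancels the coordinate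
        \<open>z\<close>, so the corresponding vectors lie in \<open>S B\<close>.\<close>
      show "(a', - r $ z) \<in> Q" for a'
      proof -
        have "r $ x = 0" if "x \<notin> insert z B" for x
          using that u w by (auto simp: S_def r_def axis_def)
        then have "r + a' *\<^sub>R ?w + (- r $ z) *\<^sub>R ?z \<in> S B"
          using w z by (auto simp: S_def axis_def)
        then have "r + a' *\<^sub>R ?w + (- r $ z) *\<^sub>R ?z \<in> D" using B by blast
        then show ?thesis by (simp add: Q_def)
      qed
      fix a b assume ab: "(a, b) \<in> Q"
      show "(a + b, b) \<in> Q" using inv_w[OF ab, of 1] by simp
      show "(a - b, b) \<in> Q" using inv_w[OF ab, of "- 1"] by simp
      show "(a, b + a) \<in> Q" using inv_z[OF ab, of "- 1"] by simp
      show "(a, b - a) \<in> Q" using inv_z[OF ab, of 1] by simp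
    qed
    then have "(a, b) \<in> Q" by simp
    then have "r + a *\<^sub>R ?w + b *\<^sub>R ?z \<in> D" by (simp add: Q_def)
    then show "u \<in> D" by (simp add: r_def)
  qed
  have "S {w} \<subseteq> D" for w
  proof
    fix u assume "u \<in> S {w}"
    then have "u $ w *\<^sub>R axis w 1 = u" by (auto simp: S_def vec_eq_iff axis_def)
    then show "u \<in> D" using axis[of "u $ w" w] by simp
  qed
  \<comment> \<open>Any single letter will do to start; \<open>undefined\<close> merely names
    one.\<close>
  then have "{undefined} \<noteq> {} \<and> S {undefined} \<subseteq> D" by blast
  moreover have "\<forall>B. B \<noteq> {} \<and> S B \<subseteq> D \<longrightarrow> card B < Suc CARD('a)"
    by (simp add: less_Suc_eq_le card_mono)
  ultimately have "\<exists>B. (B \<noteq> {} \<and> S B \<subseteq> D) \<and> (\<forall>B'. B' \<noteq> {} \<and> S B' \<subseteq> D \<longrightarrow> card B' \<le> card B)"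
    by (rule ex_has_greatest_nat)
  then obtain B where *: "(B \<noteq> {} \<and> S B \<subseteq> D) \<and> (\<forall>B'. B' \<noteq> {} \<and> S B' \<subseteq> D \<longrightarrow> card B' \<le> card B)"
    by (rule exE)
  then have B: "B \<noteq> {}" "S B \<subseteq> D" by simp_all
  have "B = UNIV"
  proof (rule ccontr)
    assume "B \<noteq> UNIV"
    then obtain w z where wz: "w \<in> B" "z \<notin> B" "omega_entry p w z \<noteq> 0"
      using ex_omega_entry_across[OF irr B(1)] by blast
    have "card (insert z B) \<le> card B"
      using * extend[OF B(2) wz] by simp
    then show False using wz(2) by simp
  qed
  moreover have "S UNIV = UNIV" by (simp add: S_def)
  ultimately show ?thesis using B(2) by auto
qed

lemma tendsto_transvec:
  assumes "s \<longlonglongrightarrow> t" "u \<longlonglongrightarrow> v"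
  shows "(\<lambda>k. transvec p (s k) (u k) x) \<longlonglongrightarrow> transvec p t v x"
proof -
  have "(\<lambda>k. Omega p (u k)) \<longlonglongrightarrow> Omega p v"
    using linear_Omega unfolding linear_conv_bounded_linear by (rule bounded_linear.tendsto[OF _ assms(2)])
  then show ?thesis
    unfolding transvec_def
    by (intro tendsto_add tendsto_const tendsto_scaleR tendsto_mult tendsto_inner assms)
qed

text \<open>The limit of the powers of a transvection sends the frame \<open>f\<close> to the one that has the direction
  of the transvection in the first place. The real transvections below have the same effect on the
  flag of \<open>f\<close>.\<close>
lemma flag_of_limit_transvec:
  assumes C: "C \<subseteq> lagr_flags p" "closed_flag_set p C" and g: "1 \<le> genus p"
    and inv: "\<And>f n. frame p f \<Longrightarrow> flag_of p f \<in> C \<Longrightarrow> flag_of p (transvec p (real n) v \<circ> f) \<in> C"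
    and f: "frame p f" "flag_of p f \<in> C" and h: "Omega p h = f 1"
    and c: "(c *\<^sub>R v) \<bullet> f 1 \<noteq> 0"
  shows "flag_of p (transvec p (1 / ((c *\<^sub>R v) \<bullet> f 1)) (c *\<^sub>R v - h) \<circ> f) \<in> C"
proof -
  define T where "T = transvec p (1 / ((c *\<^sub>R v) \<bullet> f 1)) (c *\<^sub>R v - h)"
  \<comment> \<open>Chosen so that \<open>f i - d i *\<^sub>R f 1\<close> is orthogonal to
    \<open>v\<close> and hence fixed by every power of the transvection. Only the first vector has
    to be followed to its limit.\<close>
  define d where "d i = (v \<bullet> f i) / (v \<bullet> f 1)" for i
  have v: "v \<bullet> f 1 \<noteq> 0" "c \<noteq> 0" using c by auto
  have h_f: "h \<bullet> f i = 0" if "i \<in> {1..genus p}" for i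
  proof -
    have "sympl p (f 1) (f i) = 0" "f i \<in> H p"
      using f(1) that g by (auto simp: frame_def)
    then show ?thesis using sympl_Omega[of "f i" p h] h by simp
  qed
  have h_f1: "h \<bullet> f 1 = 0" using h_f g by simp
  define G where "G = (\<lambda>i::nat. if i = 1 then 1 *\<^sub>R (T \<circ> f) 1 else (T \<circ> f) i - d i *\<^sub>R (T \<circ> f) 1)"
  have T1: "T (f 1) = c *\<^sub>R Omega p v"
    using c h h_f1 by (simp add: T_def transvec_def Omega_simps inner_diff_left)
  have Ti: "T (f i) - d i *\<^sub>R T (f 1) = f i - d i *\<^sub>R f 1" if "i \<in> {1..genus p}" for i
  proof -
    have "(c *\<^sub>R v - h) \<bullet> (f i - d i *\<^sub>R f 1) = 0"
      using v h_f[OF that] h_f1 by (simp add: d_def inner_diff_left inner_diff_right)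
    then have "T (f i - d i *\<^sub>R f 1) = f i - d i *\<^sub>R f 1" by (simp add: T_def transvec_def)
    then show ?thesis
      by (simp add: T_def linear_diff[OF linear_transvec] linear_scale[OF linear_transvec])
  qed
  \<comment> \<open>With \<open>N = Suc n\<close> the moved first vector is
    \<open>f 1 + N (v \<bullet> f 1) Omega p v\<close>. The factor turns the growing term into the
    constant \<open>c *\<^sub>R Omega p v\<close> and lets the multiple of \<open>f 1\<close> tend
    to 0.\<close>
  define F where "F n = (\<lambda>i::nat. if i = 1
      then (c / (v \<bullet> f 1) * inverse (real (Suc n))) *\<^sub>R (transvec p (real (Suc n)) v \<circ> f) 1
      else (transvec p (real (Suc n)) v \<circ> f) i - d i *\<^sub>R (transvec p (real (Suc n)) v \<circ> f) 1)" for n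
  have nz: "c / (v \<bullet> f 1) * inverse (real (Suc n)) \<noteq> 0" for n using v by simp
  have "flag_of p G \<in> C"
  proof (rule closed_flag_set_limit[OF C])
    show "\<forall>\<^sub>F n in sequentially. frame p (F n) \<and> flag_of p (F n) \<in> C"
    proof (intro always_eventually allI conjI)
      fix n
      show "frame p (F n)"
        unfolding F_def by (rule frame_triangular[OF frame_transvec[OF f(1)] nz])
      show "flag_of p (F n) \<in> C"
        unfolding F_def flag_of_triangular[OF nz] by (rule inv[OF f])
    qed
    show "frame p G"
      unfolding G_def T_def by (rule frame_triangular[OF frame_transvec[OF f(1)]]) simp
    fix i assume i: "i \<in> {1..genus p}"
    show "(\<lambda>n. F n i) \<longlonglongrightarrow> G i"
    proof (cases "i = 1")
      case True
      have "F n i = (c / (v \<bullet> f 1) * inverse (real (Suc n))) *\<^sub>R f 1 + c *\<^sub>R Omega p v" for n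
      proof -
        have "c / (v \<bullet> f 1) * inverse N * (N * (v \<bullet> f 1)) = c" if "N \<noteq> 0" for N
          using v that by simp
        from this[of "real (Suc n)"] show ?thesis
          using True by (simp add: F_def transvec_def scaleR_add_right del: of_nat_Suc)
      qed
      moreover have "(\<lambda>n. (c / (v \<bullet> f 1) * inverse (real (Suc n))) *\<^sub>R f 1 + c *\<^sub>R Omega p v) \<longlonglongrightarrow>
          (c / (v \<bullet> f 1) * 0) *\<^sub>R f 1 + c *\<^sub>R Omega p v"
        by (intro tendsto_intros LIMSEQ_inverse_real_of_nat)
      moreover have "G i = c *\<^sub>R Omega p v" using True T1 by (simp add: G_def)
      ultimately show ?thesis by simp
    next
      case False
      have "v \<bullet> (f i - d i *\<^sub>R f 1) = 0" using v by (simp add: d_def inner_diff_right)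
      then have "transvec p r v (f i - d i *\<^sub>R f 1) = f i - d i *\<^sub>R f 1" for r
        by (simp add: transvec_def)
      then have "F n i = f i - d i *\<^sub>R f 1" for n
        using False
        by (simp add: F_def linear_diff[OF linear_transvec] linear_scale[OF linear_transvec])
      then show ?thesis using Ti[OF i] False by (simp add: G_def)
    qed
  qed
  moreover have "flag_of p G = flag_of p (T \<circ> f)"
    unfolding G_def by (rule flag_of_triangular) simp
  ultimately show ?thesis by (simp add: T_def)
qed

text \<open>The set \<open>D\<close> below consists of the parameters whose limit move preserves \<open>C\<close>. Unlike the set of
  all \<open>u\<close> as in the conclusion, it visibly contains the multiples of the \<open>axis w 1\<close>.\<close>
lemma real_transvections:
  fixes p :: "'a::finite perm"
  assumes irr: "irreducible_perm p"
    and C: "C \<subseteq> lagr_flags p" "closed_flag_set p C" and g: "1 \<le> genus p"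
    and inv: "\<And>f w s. frame p f \<Longrightarrow> flag_of p f \<in> C \<Longrightarrow> s \<in> {1, -1} \<Longrightarrow>
      flag_of p (transvec p s (axis w 1) \<circ> f) \<in> C"
    and f: "frame p f" "flag_of p f \<in> C"
  shows "flag_of p (transvec p s u \<circ> f) \<in> C"
proof -
  \<comment> \<open>As \<open>h \<bullet> f 1 = 0\<close>, the coefficient
    \<open>1 / (u \<bullet> f 1)\<close> is the one for which the transvection takes
    \<open>f 1 = Omega p h\<close> to \<open>Omega p u\<close>.\<close>
  define D where "D = {u. \<forall>f h. frame p f \<and> flag_of p f \<in> C \<and> Omega p h = f 1 \<and> u \<bullet> f 1 \<noteq> 0 \<longrightarrow>
    flag_of p (transvec p (1 / (u \<bullet> f 1)) (u - h) \<circ> f) \<in> C}"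
  have inv_pow: "flag_of p (transvec p (real n) (axis w 1) \<circ> f) \<in> C"
    if f: "frame p f" "flag_of p f \<in> C" for f n w
  proof (induction n)
    case 0
    show ?case using f by simp
  next
    case (Suc n)
    have "flag_of p (transvec p 1 (axis w 1) \<circ> (transvec p (real n) (axis w 1) \<circ> f)) \<in> C"
      by (intro inv frame_transvec f Suc) simp
    then show ?case by (simp add: comp_def transvec_add add.commute)
  qed
  have "D = UNIV"
  proof (rule transvec_dual_closed_eq_UNIV[OF irr])
    show "closed D"
      unfolding closed_sequential_limits
    proof (intro allI impI)
      fix U u assume U: "(\<forall>n. U n \<in> D) \<and> U \<longlonglongrightarrow> u"
      show "u \<in> D"
        unfolding D_def
      proof (intro CollectI allI impI)
        fix f h assume fh: "frame p f \<and> flag_of p f \<in> C \<and> Omega p h = f 1 \<and> u \<bullet> f 1 \<noteq> 0"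
        have lim: "(\<lambda>n. U n \<bullet> f 1) \<longlonglongrightarrow> u \<bullet> f 1" using U by (intro tendsto_intros) auto
        have "\<forall>\<^sub>F n in sequentially. U n \<bullet> f 1 \<noteq> 0"
          using tendsto_imp_eventually_ne[OF lim] fh by blast
        then have ev: "\<forall>\<^sub>F n in sequentially.
            frame p (transvec p (1 / (U n \<bullet> f 1)) (U n - h) \<circ> f) \<and>
            flag_of p (transvec p (1 / (U n \<bullet> f 1)) (U n - h) \<circ> f) \<in> C"
          by eventually_elim (use U fh in \<open>auto simp: D_def intro: frame_transvec\<close>)
        show "flag_of p (transvec p (1 / (u \<bullet> f 1)) (u - h) \<circ> f) \<in> C"
        proof (rule closed_flag_set_limit[OF C ev])
          show "frame p (transvec p (1 / (u \<bullet> f 1)) (u - h) \<circ> f)"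
            using fh by (simp only: frame_transvec)
          have "(\<lambda>n. 1 / (U n \<bullet> f 1)) \<longlonglongrightarrow> 1 / (u \<bullet> f 1)"
            using fh by (intro tendsto_divide lim tendsto_const) simp
          moreover have "(\<lambda>n. U n - h) \<longlonglongrightarrow> u - h"
            using U by (intro tendsto_diff tendsto_const) simp
          ultimately show "(\<lambda>n. (transvec p (1 / (U n \<bullet> f 1)) (U n - h) \<circ> f) i) \<longlonglongrightarrow>
              (transvec p (1 / (u \<bullet> f 1)) (u - h) \<circ> f) i" for i
            by (simp add: tendsto_transvec)
        qed
      qed
    qed
  next
    fix u w and s :: real assume u: "u \<in> D" and s: "s \<in> {1, - 1}"
    let ?v = "axis w 1 :: real^'a"
    show "transvec_dual p s ?v u \<in> D"
      unfolding D_def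
    proof (intro CollectI allI impI)
      fix f h
      assume fh: "frame p f \<and> flag_of p f \<in> C \<and> Omega p h = f 1 \<and> transvec_dual p s ?v u \<bullet> f 1 \<noteq> 0"
      \<comment> \<open>Undo the transvection on the frame, apply the move of \<open>u\<close>
        there, and redo the transvection: conjugation turns the parameters \<open>u\<close> and
        \<open>h'\<close> into \<open>transvec_dual p s ?v u\<close> and \<open>h\<close>.\<close>
      define f' where "f' = transvec p (- s) ?v \<circ> f"
      define h' where "h' = transvec_dual p (- s) ?v h"
      have ff': "f i = transvec p s ?v (f' i)" for i by (simp add: f'_def transvec_add)
      have hh': "h = transvec_dual p s ?v h'" by (simp add: h'_def transvec_dual_inverse)
      have inner: "transvec_dual p s ?v u \<bullet> f 1 = u \<bullet> f' 1"
        unfolding ff' by (rule inner_transvec_dual)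
      have f': "frame p f'" "flag_of p f' \<in> C" "Omega p h' = f' 1"
        using fh s by (auto simp: f'_def h'_def Omega_transvec_dual intro!: frame_transvec inv)
      then have "flag_of p (transvec p (1 / (u \<bullet> f' 1)) (u - h') \<circ> f') \<in> C"
        using u fh inner by (simp add: D_def)
      then have "flag_of p (transvec p s ?v \<circ> (transvec p (1 / (u \<bullet> f' 1)) (u - h') \<circ> f')) \<in> C"
        using s by (intro inv frame_transvec f')
      also have "transvec p s ?v \<circ> (transvec p (1 / (u \<bullet> f' 1)) (u - h') \<circ> f') =
          transvec p (1 / (transvec_dual p s ?v u \<bullet> f 1)) (transvec_dual p s ?v u - h) \<circ> f"
        unfolding inner hh' transvec_dual_diff[symmetric]
        by (simp add: fun_eq_iff ff' transvec_conj)
      finally show "flag_of p (transvec p (1 / (transvec_dual p s ?v u \<bullet> f 1))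
          (transvec_dual p s ?v u - h) \<circ> f) \<in> C" .
    qed
  next
    fix c w
    show "c *\<^sub>R axis w 1 \<in> D"
      unfolding D_def
      by (intro CollectI allI impI flag_of_limit_transvec[OF C g inv_pow]) auto
  qed
  have f1: "f 1 \<in> H p" "f 1 \<noteq> 0"
    using f(1) g frame_notin_span[OF f(1), of 0] by (auto simp: frame_def)
  then obtain h where h: "Omega p h = f 1" by (auto simp: H_def)
  have h1: "h \<bullet> f 1 = 0" using inner_Omega_self[of h p] unfolding h .
  have generic: "flag_of p (transvec p s u \<circ> f) \<in> C" if u: "u \<bullet> f 1 \<noteq> 0" and s: "s \<noteq> 0" for u
  proof -
    \<comment> \<open>The move of \<open>c *\<^sub>R u + h\<close> is the transvection along
      \<open>c *\<^sub>R u\<close> with coefficient \<open>1 / (c * (u \<bullet> f 1))\<close>. The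
      factor \<open>c\<close> enters squared through the parameter, so this \<open>c\<close> gives
      strength \<open>s\<close> along \<open>u\<close>.\<close>
    define c where "c = s * (u \<bullet> f 1)"
    have c: "c \<noteq> 0" using u s by (simp add: c_def)
    have inner: "(c *\<^sub>R u + h) \<bullet> f 1 = c * (u \<bullet> f 1)" using h1 by (simp add: inner_add_left)
    have "c *\<^sub>R u + h \<in> D" using \<open>D = UNIV\<close> by simp
    then have "flag_of p (transvec p (1 / (c * (u \<bullet> f 1))) (c *\<^sub>R u + h - h) \<circ> f) \<in> C"
      using f h c u inner unfolding D_def by fastforce
    also have "transvec p (1 / (c * (u \<bullet> f 1))) (c *\<^sub>R u + h - h) = transvec p s u"
      using u s by (simp add: fun_eq_iff transvec_def Omega_simps c_def field_simps)
    finally show ?thesis .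
  qed
  show ?thesis
  proof (cases "s = 0 \<or> u \<bullet> f 1 \<noteq> 0")
    case True
    then show ?thesis using generic[of u] f by (cases "s = 0") simp_all
  next
    case False
    \<comment> \<open>Here \<open>u \<bullet> f 1 = 0\<close>, and a perturbation along
      \<open>f 1\<close> itself makes the product a positive multiple of
      \<open>f 1 \<bullet> f 1\<close>.\<close>
    define U where "U n = u + inverse (real (Suc n)) *\<^sub>R f 1" for n
    have "U \<longlonglongrightarrow> u + 0 *\<^sub>R f 1"
      unfolding U_def by (intro tendsto_intros LIMSEQ_inverse_real_of_nat)
    then have U: "U \<longlonglongrightarrow> u" by simp
    have "U n \<bullet> f 1 \<noteq> 0" for n
      using False f1 by (simp add: U_def inner_add_left)
    then have "flag_of p (transvec p s (U n) \<circ> f) \<in> C" for n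
      using False by (intro generic) auto
    then have "\<forall>\<^sub>F n in sequentially. frame p (transvec p s (U n) \<circ> f) \<and>
        flag_of p (transvec p s (U n) \<circ> f) \<in> C"
      by (simp add: frame_transvec f(1))
    then show ?thesis
      by (rule closed_flag_set_limit[OF C]) (simp_all add: frame_transvec f(1) tendsto_transvec U)
  qed
qed

section \<open>Transitivity\<close>

text \<open>The vectors of \<open>e\<close> are matched one at a time by transvections that fix
  those already matched. Distinct symplectically orthogonal vectors are not related by a single
  transvection, so each match goes through an auxiliary vector \<open>Omega p \<eta>\<close> that
  pairs nontrivially with both.\<close>

lemma frames_connected:
  assumes trans: "\<And>f s u. frame p f \<Longrightarrow> flag_of p f \<in> C \<Longrightarrow> flag_of p (transvec p s u \<circ> f) \<in> C"
    and f: "frame p f" "flag_of p f \<in> C" and e: "frame p e"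
  shows "flag_of p e \<in> C"
proof -
  have "\<exists>f. frame p f \<and> flag_of p f \<in> C \<and> (\<forall>i\<in>{1..k}. f i = e i)" if "k \<le> genus p" for k
    using that
  proof (induction k)
    case 0
    then show ?case using f by auto
  next
    case (Suc k)
    then obtain f where f: "frame p f" "flag_of p f \<in> C" "\<And>i. i \<in> {1..k} \<Longrightarrow> f i = e i"
      by auto
    let ?a = "f (Suc k)" and ?b = "e (Suc k)" and ?V = "span (e ` {1..k})"
    have k: "Suc k \<in> {1..genus p}" using Suc.prems by simp
    obtain \<alpha> \<beta> where ab: "?a = Omega p \<alpha>" "?b = Omega p \<beta>"
      using f(1) e k unfolding frame_def H_def by blast
    have \<alpha>: "\<alpha> \<bullet> e i = 0" and \<beta>: "\<beta> \<bullet> e i = 0" if i: "i \<in> {1..k}" for i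
    proof -
      have i': "i \<in> {1..genus p}" using i k by simp
      have "e i \<in> H p" "sympl p ?b (e i) = 0" using e i' k by (auto simp: frame_def)
      moreover have "sympl p ?a (f i) = 0" using f(1) i' k by (auto simp: frame_def)
      ultimately show "\<alpha> \<bullet> e i = 0" "\<beta> \<bullet> e i = 0"
        using sympl_Omega[of "e i" p \<alpha>] sympl_Omega[of "e i" p \<beta>] ab f(3)[OF i] by simp_all
    qed
    have "f ` {1..k} = e ` {1..k}" using f(3) by (intro image_cong) auto
    then have notin: "?a \<notin> ?V" "?b \<notin> ?V"
      using frame_notin_span[OF f(1), of k] frame_notin_span[OF e, of k] k by auto
    have perp: "\<exists>\<eta>. (\<forall>v\<in>?V. \<eta> \<bullet> v = 0) \<and> \<eta> \<bullet> x \<noteq> 0" if x: "x \<notin> ?V" for x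
    proof -
      let ?P = "orth_proj ?V x"
      have V: "\<forall>v\<in>?V. (x - ?P) \<bullet> v = 0" using orth_proj_orth[OF subspace_span] by blast
      have P: "?P \<in> ?V" by (rule orth_proj_in[OF subspace_span])
      then have "x - ?P \<noteq> 0" using x by auto
      then have "(x - ?P) \<bullet> (x - ?P) \<noteq> 0" by simp
      then have "(x - ?P) \<bullet> x \<noteq> 0" using V P by (simp add: inner_diff_right)
      then show ?thesis using V by blast
    qed
    obtain \<eta>1 \<eta>2 where \<eta>1: "\<forall>v\<in>?V. \<eta>1 \<bullet> v = 0" "\<eta>1 \<bullet> ?a \<noteq> 0"
      and \<eta>2: "\<forall>v\<in>?V. \<eta>2 \<bullet> v = 0" "\<eta>2 \<bullet> ?b \<noteq> 0"
      using perp[OF notin(1)] perp[OF notin(2)] by blast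
    \<comment> \<open>Two vectors, each orthogonal to \<open>?V\<close> and pairing nontrivially
      with one of \<open>?a\<close> and \<open>?b\<close>: if neither serves for both, their sum
      does.\<close>
    obtain \<eta> where \<eta>: "\<forall>v\<in>?V. \<eta> \<bullet> v = 0" "\<eta> \<bullet> ?a \<noteq> 0" "\<eta> \<bullet> ?b \<noteq> 0"
    proof -
      consider "\<eta>1 \<bullet> ?b \<noteq> 0" | "\<eta>2 \<bullet> ?a \<noteq> 0" | "\<eta>1 \<bullet> ?b = 0" "\<eta>2 \<bullet> ?a = 0" by blast
      then show ?thesis
      proof cases
        case 3
        then show ?thesis
          using \<eta>1 \<eta>2 by (intro that[of "\<eta>1 + \<eta>2"]) (simp_all add: inner_add_left)
      qed (use that \<eta>1 \<eta>2 in blast)+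
    qed
    have \<eta>e: "\<eta> \<bullet> e i = 0" if "i \<in> {1..k}" for i
      using \<eta>(1) that by (simp add: span_base)
    \<comment> \<open>\<open>f'\<close> takes \<open>?a\<close> to \<open>Omega p \<eta>\<close>,
      and \<open>f''\<close> takes this on to \<open>?b\<close>. The earlier vectors do not move,
      since they are orthogonal to \<open>\<alpha>\<close>, \<open>\<beta>\<close> and
      \<open>\<eta>\<close>.\<close>
    define f' where "f' = transvec p (1 / (\<eta> \<bullet> ?a)) (\<eta> - \<alpha>) \<circ> f"
    define f'' where "f'' = transvec p (1 / (\<beta> \<bullet> Omega p \<eta>)) (\<beta> - \<eta>) \<circ> f'"
    have f': "frame p f'" "flag_of p f' \<in> C"
      unfolding f'_def by (intro frame_transvec trans f)+
    then have f'': "frame p f''" "flag_of p f'' \<in> C"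
      unfolding f''_def by (intro frame_transvec trans f')+
    have "\<beta> \<bullet> Omega p \<eta> \<noteq> 0"
      using \<eta>(3) inner_Omega[of \<beta> p \<eta>] ab(2) by (simp add: inner_commute[of \<eta>])
    moreover have "f' (Suc k) = Omega p \<eta>"
      using \<eta>(2) ab(1) by (simp add: f'_def transvec_def inner_diff_left Omega_simps)
    ultimately have "f'' (Suc k) = ?b"
      using ab(2) by (simp add: f''_def transvec_def inner_diff_left Omega_simps)
    moreover have "f'' i = e i" if "i \<in> {1..k}" for i
      using \<alpha>[OF that] \<beta>[OF that] \<eta>e[OF that] f(3)[OF that]
      by (simp add: f''_def f'_def transvec_def inner_diff_left)
    ultimately have "\<forall>i\<in>{1..Suc k}. f'' i = e i"
      by (auto simp: le_Suc_eq)
    then show ?case using f'' by blast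
  qed
  then obtain f where f: "flag_of p f \<in> C" "\<And>i. i \<in> {1..genus p} \<Longrightarrow> f i = e i" by blast
  have "f ` {1..i} = e ` {1..i}" if "i \<in> {1..genus p}" for i
    using f(2) that by (intro image_cong) auto
  then have "flag_of p f = flag_of p e"
    by (simp add: flag_of_def fun_eq_iff)
  then show ?thesis using f(1) by simp
qed

section \<open>Cancelling the outer path, and the conclusion\<close>

lemma flag_act_eq_flag_map: "flag_act p ts = flag_map p (theta_path p ts)"
  by (simp add: flag_act_def flag_map_def fun_eq_iff)

lemma flag_map_comp: "flag_map p (S \<circ> T) F = flag_map p S (flag_map p T F)"
  by (simp add: flag_map_def fun_eq_iff image_comp)

lemma inj_flag_map:
  assumes "inj T" "F \<in> lagr_flags p" "G \<in> lagr_flags p" "flag_map p T F = flag_map p T G"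
  shows "F = G"
proof (rule ext)
  fix i
  show "F i = G i"
  proof (cases "i \<in> {1..genus p}")
    case True
    then have "T ` F i = T ` G i"
      using fun_cong[OF assms(4), of i] by (simp add: flag_map_def)
    then show ?thesis using assms(1) by (simp add: inj_image_eq_iff)
  next
    case False
    then have "E i = {}" if "E \<in> lagr_flags p" for E
      using that unfolding lagr_flags_def by blast
    then show ?thesis using assms(2,3) by metis
  qed
qed

text \<open>Allows the common outer path of two loops to be cancelled. An arrow is undone by
  subtracting the winner's coordinate, which it leaves unchanged because winner and loser
  differ.\<close>

lemma inj_theta_path:
  fixes p :: "'a::finite perm"
  assumes "irreducible_perm p" "CARD('a) \<ge> 2"
  shows "inj (theta_path p ts)"
  using assms(1)
proof (induction ts arbitrary: p)
  case (Cons t ts)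
  have "winner t p \<noteq> loser t p"
    using last_top_neq_last_bot[OF Cons.prems assms(2)] by (cases t) (auto simp: winner_def loser_def)
  then have "theta_arrow t p v $ winner t p = v $ winner t p" for v
    by (simp add: theta_arrow_def axis_def)
  then have "inj (theta_arrow t p)"
    by (intro injI) (metis add_right_cancel theta_arrow_def)
  then show ?case
    unfolding theta_path.simps
    by (intro inj_compose Cons.IH[OF irreducible_rauzy_step[OF Cons.prems assms(2)]])
qed simp

theorem theorem5p1:
  fixes p :: "'a::finite perm"
  assumes "CARD('a) \<ge> 2"
    and "irreducible_perm p"
    and "C \<subseteq> lagr_flags p"
    and "C \<noteq> {}"
    and "closed_flag_set p C"
    and "\<forall>ts\<in>rauzy_monoid p. flag_act p ts ` C = C"
  shows "C = lagr_flags p"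
proof (cases "genus p = 0")
  case True
  \<comment> \<open>Treated separately because the limit argument needs a first frame
    vector.\<close>
  then have "F = (\<lambda>i. {})" if "F \<in> lagr_flags p" for F
    using that by (auto simp: lagr_flags_def fun_eq_iff)
  then show ?thesis using assms(3,4) by blast
next
  case False
  have inv: "flag_of p (transvec p s (axis w 1) \<circ> f) \<in> C"
    if f: "frame p f" "flag_of p f \<in> C" and s: "s \<in> {1, - 1}" for f w s
  proof -
    obtain \<gamma> \<delta> \<eta> \<sigma> where paths: "\<gamma> @ \<delta> \<in> rauzy_monoid p" "\<gamma> @ \<eta> @ \<delta> \<in> rauzy_monoid p"
      and \<sigma>: "\<sigma> \<in> {1, - 1}"
      and theta: "theta_path p (\<gamma> @ \<eta> @ \<delta>) =
        theta_path p (\<gamma> @ \<delta>) \<circ> (\<lambda>v. v + \<sigma> *\<^sub>R v $ w *\<^sub>R Omega p (axis w 1))"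
      by (rule ex_rauzy_transvection[OF assms(2,1)])
    define T where "T s = transvec p s (axis w 1)" for s
    define A where "A = flag_map p (theta_path p (\<gamma> @ \<delta>))"
    have "(\<lambda>v. v + \<sigma> *\<^sub>R v $ w *\<^sub>R Omega p (axis w 1)) = T \<sigma>"
      by (simp add: T_def transvec_def fun_eq_iff inner_axis')
    then have comp: "flag_map p (theta_path p (\<gamma> @ \<eta> @ \<delta>)) F = A (flag_map p (T \<sigma>) F)" for F
      by (simp only: theta flag_map_comp A_def)
    have A: "A ` C = C" "(\<lambda>F. A (flag_map p (T \<sigma>) F)) ` C = C"
      using assms(6) paths by (simp_all add: flag_act_eq_flag_map A_def flip: comp[unfolded A_def])
    have inj_A: "F = G" if "F \<in> lagr_flags p" "G \<in> lagr_flags p" "A F = A G" for F G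
      using inj_flag_map[OF inj_theta_path[OF assms(2,1)]] that unfolding A_def by blast
    have T_flag: "flag_map p (T r) (flag_of p f) = flag_of p (T r \<circ> f)" for r f
      unfolding T_def by (rule flag_map_flag_of[OF linear_transvec])
    have T_lagr: "flag_map p (T r) F \<in> lagr_flags p" if F: "F \<in> lagr_flags p" for r F
    proof -
      obtain f where "frame p f" "flag_of p f = F" by (rule ex_frame[OF F])
      then show ?thesis
        using T_flag[of r f] flag_of_in_lagr_flags[OF frame_transvec] unfolding T_def by metis
    qed
    have plus: "flag_map p (T \<sigma>) F \<in> C" if F: "F \<in> C" for F
    proof -
      have "A (flag_map p (T \<sigma>) F) \<in> A ` C" using A F by blast
      then obtain G where "G \<in> C" "A (flag_map p (T \<sigma>) F) = A G" by blast
      then show ?thesis using inj_A[of "flag_map p (T \<sigma>) F" G] T_lagr[of F \<sigma>] F assms(3) by auto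
    qed
    \<comment> \<open>After cancelling \<open>A\<close>, every flag of \<open>C\<close> is the image
      of a flag of \<open>C\<close> under the transvection; this yields the inverse.\<close>
    have minus: "flag_map p (T (- \<sigma>)) F \<in> C" if F: "F \<in> C" for F
    proof -
      have "A F \<in> (\<lambda>F. A (flag_map p (T \<sigma>) F)) ` C" using A F by blast
      then obtain G where G: "G \<in> C" "A F = A (flag_map p (T \<sigma>) G)" by blast
      then have "F = flag_map p (T \<sigma>) G"
        using inj_A[of F "flag_map p (T \<sigma>) G"] T_lagr[of G \<sigma>] F assms(3) by auto
      then have "flag_map p (T (- \<sigma>)) F = flag_map p id G"
        by (simp add: flag_map_comp[symmetric] T_def comp_def transvec_add id_def)
      also have "\<dots> = G"
        using G(1) assms(3) by (auto simp: flag_map_def lagr_flags_def fun_eq_iff)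
      finally show ?thesis using G(1) by simp
    qed
    have "s = \<sigma> \<or> s = - \<sigma>" using s \<sigma> by auto
    then show ?thesis
      using plus[OF f(2)] minus[OF f(2)] T_flag[of s f] by (auto simp: T_def)
  qed
  obtain F where F: "F \<in> C" using assms(4) by blast
  obtain f where f: "frame p f" "flag_of p f = F"
    by (rule ex_frame) (use F assms(3) in blast)
  have "lagr_flags p \<subseteq> C"
  proof
    fix E assume "E \<in> lagr_flags p"
    then obtain e where e: "frame p e" "flag_of p e = E" by (rule ex_frame)
    have "1 \<le> genus p" using False by simp
    have "flag_of p e \<in> C"
      by (rule frames_connected[OF real_transvections[OF assms(2,3,5) \<open>1 \<le> genus p\<close> inv] f(1) _ e(1)])
        (use f F in auto)
    then show "E \<in> C" using e by simp
  qed
  then show ?thesis using assms(3) by blast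
qed

end
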